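(* If $p, q \in \mathbb{N}$ and $pq \le 6$, then $J_p(M_q) \subseteq \overline{M_q^+ \otimes M_p^+}$.
   Context: $M_n = B(\mathbb{C}^n)$ is the C*-algebra of $n \times n$ complex matrices, $M_n^+$ its cone of positive semidefinite matrices, and $\succeq 0$ means positive semidefinite. $M_q^+ \otimes M_p^+$ denotes the convex cone in $M_q \otimes M_p$ generated by elementary tensors $s \otimes X$ with $s \in M_q^+$, $X \in M_p^+$; the bar denotes closure in $M_q \otimes M_p$. Positivity in $M_q \otimes M_p$ is positivity in $B(\mathbb{C}^q \otimes \mathbb{C}^p)$. With $t$ a transpose on $M_p$ (with respect to an orthonormal basis; the choice is immaterial), $$J_p(M_q) = \Big\{ S = \sum_j s_j \otimes x_j \in M_q \otimes M_p \ (\text{finite sum}) : S \succeq 0 \text{ and } \sum_j s_j \otimes t(x_j) \succeq 0 \Big\}.$$ *)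

theory Defs
  imports "HOL-Analysis.Analysis"
begin

text \<open>
  The matrix algebra M_n is the type \<open>complex^'n^'n\<close> with n = \<open>CARD('n)\<close>. The space
  \<open>\<complex>\<^sup>q \<otimes> \<complex>\<^sup>p\<close> is \<open>complex^('q \<times> 'p)\<close>, where \<open>e\<^sub>i \<otimes> e\<^sub>k\<close> is the basis vector
  with index \<open>(i, k)\<close>; accordingly \<open>M_q \<otimes> M_p\<close> is \<open>complex^('q \<times> 'p)^('q \<times> 'p)\<close>.
\<close>

text \<open>
  Over the complex numbers, a nonnegative quadratic form already forces the matrix to be
  Hermitian, so no separate condition is needed.
\<close>

definition psd :: "complex^'n^'n \<Rightarrow> bool"
  where "psd A \<longleftrightarrow> (\<forall>v. (\<Sum>i\<in>UNIV. cnj (v $ i) * (A *v v) $ i) \<in> \<real>\<^sub>\<ge>\<^sub>0)"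

definition tensor_mat ::
    "complex^'q^'q \<Rightarrow> complex^'p^'p \<Rightarrow> complex^('q \<times> 'p)^('q \<times> 'p)"  (infixr "\<otimes>\<^sub>M" 72)
  where "s \<otimes>\<^sub>M x = (\<chi> a b. s $ fst a $ fst b * x $ snd a $ snd b)"

definition separable_cone :: "(complex^('q::finite \<times> 'p::finite)^('q \<times> 'p)) set"
  where "separable_cone = convex_cone hull {s \<otimes>\<^sub>M x | s x. psd s \<and> psd x}"

text \<open>
  The set \<open>J_p(M_q)\<close>, with p and q read off from the type. The transpose on M_p is taken with
  respect to the standard basis; changing the orthonormal basis conjugates the partially
  transposed matrix by a unitary \<open>1 \<otimes> u\<close> and so does not change the set.
\<close>

definition J :: "(complex^('q::finite \<times> 'p::finite)^('q \<times> 'p)) set"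
  where "J = {S. \<exists>(n::nat) s x. S = (\<Sum>j<n. s j \<otimes>\<^sub>M x j) \<and> psd S
                  \<and> psd (\<Sum>j<n. s j \<otimes>\<^sub>M transpose (x j))}"

end

theory Submission
  imports Defs "HOL-Computational_Algebra.Fundamental_Theorem_Algebra"
begin

text \<open>
  Splitting off a trace-maximal element of the closed separable cone leaves an edge matrix \<open>S\<close>:
  no product vector \<open>x \<otimes> y\<close> in the range of \<open>S\<close> has \<open>x \<otimes> cnj y\<close> in the range of the partial
  transpose, since otherwise a small multiple of its projection could still be subtracted. It
  remains to see that a nonzero edge matrix does not exist. Say one factor has dimension 2, and
  write \<open>S\<close> in blocks \<open>A, B, B\<^sup>*, C\<close> of size at most 3. After removing the kernel of \<open>A\<close> one
  may assume \<open>A = 1\<close>, so that \<open>F = C - B\<^sup>* B\<close> and \<open>G = C - B B\<^sup>*\<close> are positive semidefinite with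
  the same trace, and their ranges meet only in 0. Hence the ranks of \<open>F\<close> and \<open>G\<close> are
  \<open>(0, 0)\<close>, \<open>(1, 1)\<close>, \<open>(1, 2)\<close> or \<open>(2, 1)\<close>. In the first case \<open>B\<close> is normal, and its
  eigenvectors give a forbidden product vector. In the second \<open>B\<close> is the corner of a normal
  matrix with one more row and column, whose eigenvectors do. In the remaining cases a
  product vector is a zero of a determinant \<open>cnj \<alpha> \<alpha>\<^sup>2 + O(\<bar>\<alpha>\<bar>\<^sup>2)\<close>, which exists by Brouwer's
  fixed point theorem because the leading term has winding number 1.
\<close>

section \<open>Positive semidefinite matrices\<close>

text \<open>Conjugate linear in the first argument, so that \<open>hip v (A *v v)\<close> is
  literally the sum in the definition of \<open>psd\<close>.\<close>

definition hip :: "complex^'n \<Rightarrow> complex^'n \<Rightarrow> complex"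
  where "hip x y = (\<Sum>i\<in>UNIV. cnj (x $ i) * y $ i)"

definition adj :: "complex^'n^'m \<Rightarrow> complex^'m^'n"
  where "adj A = (\<chi> i j. cnj (A $ j $ i))"

definition outer :: "complex^'n \<Rightarrow> complex^'n^'n"
  where "outer u = (\<chi> i j. u $ i * cnj (u $ j))"

lemma hip_add_right: "hip x (y + z) = hip x y + hip x z"
  by (simp add: hip_def algebra_simps sum.distrib)

lemma hip_add_left: "hip (x + y) z = hip x z + hip y z"
  by (simp add: hip_def algebra_simps sum.distrib)

lemma hip_scale_right: "hip x (c *s y) = c * hip x y"
  by (simp add: hip_def sum_distrib_left algebra_simps)

lemma hip_scale_left: "hip (c *s x) y = cnj c * hip x y"
  by (simp add: hip_def sum_distrib_left algebra_simps)

lemma hip_minus_right: "hip x (- y) = - hip x y"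
  by (simp add: hip_def sum_negf)

lemma hip_minus_left: "hip (- x) y = - hip x y"
  by (simp add: hip_def sum_negf)

lemma hip_diff_right: "hip x (y - z) = hip x y - hip x z"
  by (simp add: hip_def algebra_simps sum_subtractf)

lemma hip_diff_left: "hip (x - y) z = hip x z - hip y z"
  by (simp add: hip_def algebra_simps sum_subtractf)

lemma hip_zero_right [simp]: "hip x 0 = 0"
  by (simp add: hip_def)

lemma hip_zero_left [simp]: "hip 0 x = 0"
  by (simp add: hip_def)

lemmas hip_linear =
  hip_add_right hip_add_left hip_scale_right hip_scale_left
  hip_minus_right hip_minus_left hip_diff_right hip_diff_left

lemma cnj_hip: "cnj (hip x y) = hip y x"
  by (simp add: hip_def mult.commute)

lemma hip_self: "hip x x = of_real ((norm x)\<^sup>2)"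
proof -
  have "hip x x = of_real (\<Sum>i\<in>UNIV. (norm (x $ i))\<^sup>2)"
    by (simp add: hip_def complex_norm_square mult.commute del: of_real_power)
  also have "(\<Sum>i\<in>UNIV. (norm (x $ i))\<^sup>2) = (norm x)\<^sup>2"
    by (simp add: norm_vec_def L2_set_def sum_nonneg)
  finally show ?thesis .
qed

lemma hip_self_eq_0 [simp]: "hip x x = 0 \<longleftrightarrow> x = 0"
  by (simp add: hip_self)

lemma hip_eq_0_imp: "(\<And>x. hip x y = 0) \<Longrightarrow> y = 0"
  using hip_self_eq_0 by blast

lemma hip_left_eq: "(\<And>y. hip x y = hip x' y) \<Longrightarrow> x = x'"
  using hip_self_eq_0[of "x - x'"] by (simp add: hip_diff_left)

lemma hip_adj: "hip x (A *v y) = hip (adj A *v x) y"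
proof -
  have "hip x (A *v y) = (\<Sum>i\<in>UNIV. \<Sum>j\<in>UNIV. cnj (x $ i) * (A $ i $ j * y $ j))"
    by (simp add: hip_def matrix_vector_mult_def sum_distrib_left)
  also have "\<dots> = (\<Sum>j\<in>UNIV. \<Sum>i\<in>UNIV. cnj (x $ i) * (A $ i $ j * y $ j))"
    by (rule sum.swap)
  also have "\<dots> = hip (adj A *v x) y"
    by (simp add: hip_def matrix_vector_mult_def sum_distrib_right sum_distrib_left adj_def mult_ac)
  finally show ?thesis .
qed

lemma adj_adj [simp]: "adj (adj A) = A"
  by (simp add: adj_def vec_eq_iff)

lemma hip_adj': "hip (A *v x) y = hip x (adj A *v y)"
  by (simp add: hip_adj)

lemma adj_mult: "adj (A ** B) = adj B ** adj A"
  by (simp add: adj_def matrix_matrix_mult_def vec_eq_iff mult.commute)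

lemma adj_mat_1 [simp]: "adj (mat 1) = mat 1"
  by (simp add: adj_def mat_def vec_eq_iff)

lemma matrix_eqI: "(\<And>x. A *v x = B *v x) \<Longrightarrow> A = (B :: complex^'n^'m)"
  using matrix_eq by blast

lemma outer_mult_vec: "outer u *v x = hip u x *s u"
  by (simp add: outer_def matrix_vector_mult_def hip_def vec_eq_iff sum_distrib_left
      sum_distrib_right mult_ac)

lemma hip_scaleR_right: "hip x (c *\<^sub>R y) = of_real c * hip x y"
proof -
  have "hip x (c *\<^sub>R y) = c *\<^sub>R hip x y"
    by (simp add: hip_def scaleR_sum_right)
  then show ?thesis by (simp add: scaleR_conv_of_real)
qed

lemma hip_mult_hip: "hip x y * hip y x = of_real ((cmod (hip x y))\<^sup>2)"
  by (metis cnj_hip complex_norm_square)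

lemma mult_vec_scale: "A *v (c *s x) = c *s (A *v (x :: complex^'n))"
  by (simp add: matrix_vector_mult_def vec_eq_iff sum_distrib_left mult_ac)

lemmas mult_vec_linear =
  mult_vec_scale matrix_vector_right_distrib matrix_vector_mult_diff_distrib

lemma scaleR_matrix_vector: "(c *\<^sub>R A) *v x = c *\<^sub>R (A *v (x :: complex^'n))"
  by (simp add: matrix_vector_mult_def vec_eq_iff scaleR_sum_right)

section \<open>Hermitian symmetry, Cauchy-Schwarz and rank-one subtraction\<close>

lemma psd_hip: "psd A \<longleftrightarrow> (\<forall>v. hip v (A *v v) \<in> \<real>\<^sub>\<ge>\<^sub>0)"
  by (simp add: psd_def hip_def)

lemma psd_real: "psd A \<Longrightarrow> Im (hip v (A *v v)) = 0"
  and psd_nonneg: "psd A \<Longrightarrow> 0 \<le> Re (hip v (A *v v))"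
  by (auto simp: psd_hip complex_nonneg_Reals_iff)

lemma psdI: "(\<And>v. 0 \<le> Re (hip v (A *v v))) \<Longrightarrow> (\<And>v. Im (hip v (A *v v)) = 0) \<Longrightarrow> psd A"
  by (auto simp: psd_hip complex_nonneg_Reals_iff)

text \<open>Polarization: the form is real at \<open>x\<close>, \<open>y\<close>,
  \<open>x + y\<close> and \<open>x + \<i> *s y\<close>, which fixes the real and imaginary parts of
  the mixed terms.\<close>

lemma psd_hip_commute:
  assumes "psd A"
  shows "hip y (A *v x) = cnj (hip x (A *v y))"
proof -
  have 1: "Im (hip (x + y) (A *v (x + y))) = 0" "Im (hip (x + \<i> *s y) (A *v (x + \<i> *s y))) = 0"
    "Im (hip x (A *v x)) = 0" "Im (hip y (A *v y)) = 0"
    using psd_real[OF assms] by blast+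
  show ?thesis
    using 1 by (auto simp: mult_vec_linear hip_linear complex_eq_iff)
qed

lemma psd_adj: "psd A \<Longrightarrow> adj A = A"
  by (intro matrix_eqI hip_left_eq) (metis cnj_hip hip_adj psd_hip_commute)

lemma psd_cnj:
  assumes "psd A"
  shows "cnj (A $ j $ i) = A $ i $ j"
proof -
  have "adj A $ i $ j = A $ i $ j" by (simp add: psd_adj[OF assms])
  then show ?thesis by (simp add: adj_def)
qed

text \<open>Cauchy-Schwarz for a possibly degenerate form, from its nonnegativity at
  \<open>y - (of_real k * m) *s x\<close> for all real \<open>k\<close>, where \<open>m\<close> is
  the mixed term.\<close>

lemma psd_CS:
  assumes "psd A"
  shows "(cmod (hip x (A *v y)))\<^sup>2 \<le> Re (hip x (A *v x)) * Re (hip y (A *v y))"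
proof -
  define c d m where "c = Re (hip x (A *v x))" and "d = Re (hip y (A *v y))" and "m = hip x (A *v y)"
  have c0: "c \<ge> 0" and d0: "d \<ge> 0"
    using psd_nonneg[OF assms] by (auto simp: c_def d_def)
  have m': "hip y (A *v x) = cnj m"
    unfolding m_def by (rule psd_hip_commute[OF assms])
  have ineq: "0 \<le> d - 2 * k * (cmod m)\<^sup>2 + k\<^sup>2 * (cmod m)\<^sup>2 * c" for k :: real
  proof -
    have "0 \<le> Re (hip (y - (of_real k * m) *s x) (A *v (y - (of_real k * m) *s x)))"
      using psd_nonneg[OF assms] .
    also have "\<dots> = d - 2 * k * (cmod m)\<^sup>2 + k\<^sup>2 * (cmod m)\<^sup>2 * c"
    proof -
      have xx: "hip x (A *v x) = of_real c"
        using psd_real[OF assms, of x] by (simp add: c_def complex_eq_iff)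
      show ?thesis
        unfolding cmod_power2
        by (simp add: mult_vec_linear hip_linear m' xx flip: m_def d_def)
          (simp add: power2_eq_square algebra_simps)
    qed
    finally show ?thesis .
  qed
  have "(cmod m)\<^sup>2 \<le> c * d"
  proof (cases "c = 0")
    case True
    have "cmod m = 0"
    proof (rule ccontr)
      assume "cmod m \<noteq> 0"
      \<comment> \<open>For \<open>c = 0\<close> the bound is affine in \<open>k\<close>; this
        \<open>k\<close> gives it the value \<open>d - (d + 1) = -1\<close>.\<close>
      then have "2 * ((d + 1) / (2 * (cmod m)\<^sup>2)) * (cmod m)\<^sup>2 = d + 1" by (simp add: field_simps)
      with ineq[of "(d + 1) / (2 * (cmod m)\<^sup>2)"] True show False by simp
    qed
    with True show ?thesis by simp
  next
    case False
    with c0 have "c > 0" by simp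
    \<comment> \<open>\<open>1 / c\<close> minimizes the quadratic in \<open>k\<close>.\<close>
    with ineq[of "1 / c"] show ?thesis
      by (simp add: field_simps power2_eq_square)
  qed
  then show ?thesis by (simp add: c_def d_def m_def)
qed

lemma psd_kernel:
  assumes "psd A" "Re (hip x (A *v x)) = 0"
  shows "A *v x = 0"
proof (rule hip_eq_0_imp)
  fix y
  show "hip y (A *v x) = 0"
    using psd_CS[OF assms(1), of y x] assms(2) by simp
qed

lemma psd_outer: "psd (outer u)"
proof -
  have "hip v (outer u *v v) = of_real ((cmod (hip u v))\<^sup>2)" for v
    by (simp add: outer_mult_vec hip_scale_right hip_mult_hip del: of_real_power)
  then show ?thesis by (intro psdI) auto
qed

lemma psd_add: "psd A \<Longrightarrow> psd B \<Longrightarrow> psd (A + B)"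
  by (auto simp: psd_hip matrix_vector_mult_add_rdistrib hip_linear nonneg_Reals_add_I)

lemma psd_scaleR: "psd A \<Longrightarrow> 0 \<le> c \<Longrightarrow> psd (c *\<^sub>R A)"
  by (intro psdI) (auto simp: scaleR_matrix_vector hip_scaleR_right psd_nonneg psd_real)

lemma psd_zero [simp]: "psd 0"
  by (simp add: psd_hip)

text \<open>Since \<open>hip w v = hip z (A *v v)\<close>, Cauchy-Schwarz bounds the form of
  \<open>outer w\<close> by \<open>hip z (A *v z)\<close> times that of \<open>A\<close>. Thus a
  small rank-one piece along any vector of the range can be subtracted.\<close>

lemma psd_diff_outer:
  assumes "psd A" "A *v z = w" "0 \<le> e" "e * Re (hip z (A *v z)) \<le> 1"
  shows "psd (A - e *\<^sub>R outer w)"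
proof (rule psdI)
  fix v
  have q: "hip v ((A - e *\<^sub>R outer w) *v v) = hip v (A *v v) - of_real (e * (cmod (hip w v))\<^sup>2)"
    by (simp add: matrix_vector_mult_diff_rdistrib scaleR_matrix_vector outer_mult_vec hip_linear
        hip_scaleR_right hip_mult_hip del: of_real_power)
  have "hip w v = hip z (A *v v)"
    using psd_adj[OF assms(1)] assms(2) by (metis hip_adj)
  then have "e * (cmod (hip w v))\<^sup>2 \<le> e * (Re (hip z (A *v z)) * Re (hip v (A *v v)))"
    using psd_CS[OF assms(1), of z v] assms(3) by (simp add: mult_left_mono)
  also have "\<dots> \<le> 1 * Re (hip v (A *v v))"
    using mult_right_mono[OF assms(4) psd_nonneg[OF assms(1)]] by (simp add: mult_ac)
  finally show "0 \<le> Re (hip v ((A - e *\<^sub>R outer w) *v v))" by (simp add: q)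
  show "Im (hip v ((A - e *\<^sub>R outer w) *v v)) = 0" by (simp add: q psd_real[OF assms(1)])
qed

lemma hip_axis:
  fixes A :: "complex^'n^'n"
  shows "hip (axis i 1) (A *v axis j 1) = A $ i $ j"
proof -
  have "hip (axis i 1) y = y $ i" for y :: "complex^'n"
    by (simp add: hip_def axis_def if_distrib[of cnj] if_distrib[of "\<lambda>c. c * _"] cong: if_cong)
  then show ?thesis by (simp add: matrix_vector_mult_def axis_def if_distrib cong: if_cong)
qed

text \<open>A crude consequence of Cauchy-Schwarz. It serves to bound a matrix by its diagonal and
  to see that a zero diagonal forces the zero matrix.\<close>

lemma psd_entry_le:
  assumes "psd A"
  shows "norm (A $ i $ j) \<le> Re (A $ i $ i) + Re (A $ j $ j)"
proof -
  have d: "0 \<le> Re (A $ k $ k)" for k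
    using psd_nonneg[OF assms, of "axis k 1"] by (simp add: hip_axis)
  have "(norm (A $ i $ j))\<^sup>2 \<le> Re (A $ i $ i) * Re (A $ j $ j)"
    using psd_CS[OF assms, of "axis i 1" "axis j 1"] by (simp add: hip_axis)
  also have "\<dots> \<le> (Re (A $ i $ i) + Re (A $ j $ j))\<^sup>2"
    using d[of i] d[of j] by (simp add: power2_sum) 
  finally show ?thesis
    using d[of i] d[of j] power2_le_imp_le by (metis add_nonneg_nonneg)
qed

lemma continuous_on_hip_mult: "continuous_on S (\<lambda>A. hip v (A *v w))"
  unfolding hip_def matrix_vector_mult_def by (auto intro!: continuous_intros)

lemma closed_psd: "closed {A :: complex^'n^'n. psd A}"
proof -
  have "{A :: complex^'n^'n. psd A} = (\<Inter>v. (\<lambda>A. hip v (A *v v)) -` \<real>\<^sub>\<ge>\<^sub>0)"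
    by (auto simp: psd_hip)
  then show ?thesis
    by (auto intro!: closed_INT closed_vimage continuous_on_hip_mult)
qed

section \<open>Edge matrices\<close>

definition tensor_vec :: "complex^'q::finite \<Rightarrow> complex^'p::finite \<Rightarrow> complex^('q \<times> 'p)"
  where "tensor_vec x y = (\<chi> a. x $ fst a * y $ snd a)"

definition vcnj :: "complex^'n \<Rightarrow> complex^'n"
  where "vcnj x = (\<chi> i. cnj (x $ i))"

text \<open>Given by entries, hence independent of any decomposition into elementary
  tensors.\<close>

definition ptranspose :: "complex^('q::finite \<times> 'p::finite)^('q \<times> 'p) \<Rightarrow> complex^('q \<times> 'p)^('q \<times> 'p)"
  where "ptranspose S = (\<chi> a b. S $ (fst a, snd b) $ (fst b, snd a))"

lemma outer_tensor_vec: "outer (tensor_vec x y) = outer x \<otimes>\<^sub>M outer y"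
  by (simp add: outer_def tensor_vec_def tensor_mat_def vec_eq_iff)

lemma ptranspose_tensor: "ptranspose (s \<otimes>\<^sub>M x) = s \<otimes>\<^sub>M transpose x"
  by (simp add: ptranspose_def tensor_mat_def transpose_def vec_eq_iff)

lemma ptranspose_outer_tensor_vec: "ptranspose (outer (tensor_vec x y)) = outer (tensor_vec x (vcnj y))"
  by (simp add: ptranspose_def outer_def tensor_vec_def vcnj_def vec_eq_iff)

lemma ptranspose_diff: "ptranspose (S - T) = ptranspose S - ptranspose T"
  and ptranspose_add: "ptranspose (S + T) = ptranspose S + ptranspose T"
  and ptranspose_scaleR: "ptranspose (c *\<^sub>R S) = c *\<^sub>R ptranspose S"
  and ptranspose_zero [simp]: "ptranspose 0 = 0"
  and ptranspose_ptranspose [simp]: "ptranspose (ptranspose S) = S"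
  by (simp_all add: ptranspose_def vec_eq_iff)

lemma tensor_vec_eq_0_iff [simp]: "tensor_vec x y = 0 \<longleftrightarrow> x = 0 \<or> y = 0"
  by (auto simp: tensor_vec_def vec_eq_iff)

lemma ptranspose_sum: "ptranspose (sum f I) = (\<Sum>i\<in>I. ptranspose (f i))"
  by (induction I rule: infinite_finite_induct) (simp_all add: ptranspose_add)

lemma J_imp_ppt:
  assumes "S \<in> J"
  shows "psd S" "psd (ptranspose S)"
  using assms by (auto simp: J_def ptranspose_sum ptranspose_tensor)

definition edge :: "complex^('q::finite \<times> 'p::finite)^('q \<times> 'p) \<Rightarrow> bool"
  where "edge S \<longleftrightarrow> psd S \<and> psd (ptranspose S) \<and>
    (\<forall>x y. tensor_vec x y \<in> range ((*v) S) \<longrightarrow> tensor_vec x (vcnj y) \<in> range ((*v) (ptranspose S)) \<longrightarrow> x = 0 \<or> y = 0)"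

text \<open>\<open>T\<close> maximizes the trace over a compact set of admissible elements of
  \<open>K\<close>. The cone is kept abstract; it will be the closure of the separable cone.\<close>

lemma exists_edge_remainder:
  fixes K :: "(complex^('q::finite \<times> 'p::finite)^('q \<times> 'p)) set"
  assumes K: "closed K" "convex_cone K" "\<And>x y. outer (tensor_vec x y) \<in> K"
    and S: "psd S" "psd (ptranspose S)"
  obtains T where "T \<in> K" "edge (S - T)"
proof -
  \<comment> \<open>\<open>psd T\<close> bounds the entries of \<open>T\<close> by its diagonal, and
    \<open>psd (S - T)\<close> bounds that diagonal by the one of \<open>S\<close>; this makes
    \<open>X\<close> compact.\<close>
  define X where "X = {T \<in> K. psd T \<and> psd (S - T) \<and> psd (ptranspose (S - T))}"
  define tr where "tr = (\<lambda>T :: complex^('q \<times> 'p)^('q \<times> 'p). \<Sum>a\<in>UNIV. Re (T $ a $ a))"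
  have cont_ptranspose: "continuous_on UNIV (\<lambda>T. ptranspose (S - T))"
    unfolding ptranspose_def by (auto intro!: continuous_intros)
  have "X = K \<inter> {T. psd T} \<inter> (\<lambda>T. S - T) -` {T. psd T} \<inter> (\<lambda>T. ptranspose (S - T)) -` {T. psd T}"
    by (auto simp: X_def)
  moreover have "closed ((\<lambda>T. S - T) -` {T. psd T})" "closed ((\<lambda>T. ptranspose (S - T)) -` {T. psd T})"
    by (intro closed_vimage closed_psd cont_ptranspose continuous_intros)+
  ultimately have "closed X"
    using K(1) closed_psd by auto
  moreover have "bounded X"
  proof (rule boundedI)
    fix T assume "T \<in> X"
    then have T: "psd T" "psd (S - T)" by (auto simp: X_def)
    have d: "Re (T $ a $ a) \<le> Re (S $ a $ a)" for a
      using psd_nonneg[OF T(2), of "axis a 1"] by (simp add: hip_axis)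
    have "norm T \<le> (\<Sum>a\<in>UNIV. norm (T $ a))"
      by (simp add: norm_vec_def L2_set_le_sum)
    also have "\<dots> \<le> (\<Sum>a\<in>UNIV. \<Sum>b\<in>UNIV. norm (T $ a $ b))"
      by (intro sum_mono) (simp add: norm_vec_def L2_set_le_sum)
    also have "\<dots> \<le> (\<Sum>a\<in>UNIV. \<Sum>b\<in>UNIV. Re (S $ a $ a) + Re (S $ b $ b))"
      by (intro sum_mono order_trans[OF psd_entry_le[OF T(1)]] add_mono d)
    finally show "norm T \<le> (\<Sum>a\<in>UNIV. \<Sum>b\<in>UNIV. Re (S $ a $ a) + Re (S $ b $ b))" .
  qed
  moreover have "0 \<in> X"
    using S K(2) by (simp add: X_def convex_cone_contains_0)
  moreover have "continuous_on X tr"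
    unfolding tr_def by (intro continuous_intros)
  ultimately obtain T where T: "T \<in> X" and max: "\<And>T'. T' \<in> X \<Longrightarrow> tr T' \<le> tr T"
    using continuous_attains_sup[of X tr] by (auto simp: compact_eq_bounded_closed)
  have "x = 0 \<or> y = 0"
    if "tensor_vec x y \<in> range ((*v) (S - T))" "tensor_vec x (vcnj y) \<in> range ((*v) (ptranspose (S - T)))" for x y
  proof -
    from that obtain z z' where z: "(S - T) *v z = tensor_vec x y"
      and z': "ptranspose (S - T) *v z' = tensor_vec x (vcnj y)"
      by (metis rangeE)
    define c c' where "c = Re (hip z ((S - T) *v z))" and "c' = Re (hip z' (ptranspose (S - T) *v z'))"
    have ST: "psd T" "psd (S - T)" "psd (ptranspose (S - T))" "T \<in> K"
      using T by (auto simp: X_def)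
    have c: "0 \<le> c" "0 \<le> c'"
      using ST by (auto simp: c_def c'_def psd_nonneg)
    define e where "e = 1 / (1 + c + c')"
    have e: "e > 0" "e * c \<le> 1" "e * c' \<le> 1"
      using c by (auto simp: e_def field_simps)
    have "psd (S - T - e *\<^sub>R outer (tensor_vec x y))"
      using psd_diff_outer[OF ST(2) z] e by (simp add: c_def)
    moreover have "psd (ptranspose (S - T) - e *\<^sub>R outer (tensor_vec x (vcnj y)))"
      using psd_diff_outer[OF ST(3) z'] e by (simp add: c'_def)
    moreover have "T + e *\<^sub>R outer (tensor_vec x y) \<in> K"
      using K ST(4) e by (simp add: convex_cone_add convex_cone_scaleR)
    moreover have "psd (T + e *\<^sub>R outer (tensor_vec x y))"
      using ST e by (simp add: psd_add psd_scaleR psd_outer)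
    ultimately have "T + e *\<^sub>R outer (tensor_vec x y) \<in> X"
      by (simp add: X_def ptranspose_diff ptranspose_add ptranspose_scaleR ptranspose_outer_tensor_vec diff_diff_eq)
    \<comment> \<open>Enlarging \<open>T\<close> raises its trace by \<open>e\<close> times the
      squared norm of the product vector, so maximality makes that vector zero.\<close>
    from max[OF this] have "e * tr (outer (tensor_vec x y)) \<le> 0"
      by (simp add: tr_def sum.distrib sum_distrib_left)
    moreover have "tr (outer (tensor_vec x y)) = (norm (tensor_vec x y))\<^sup>2"
    proof -
      have "complex_of_real (tr (outer (tensor_vec x y))) = hip (tensor_vec x y) (tensor_vec x y)"
        unfolding tr_def hip_def of_real_sum
        by (intro sum.cong refl) (simp add: outer_def complex_eq_iff algebra_simps)
      then show ?thesis unfolding hip_self of_real_eq_iff .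
    qed
    ultimately show "x = 0 \<or> y = 0"
      using e(1) by (auto simp: mult_le_0_iff)
  qed
  with T have "T \<in> K" "edge (S - T)"
    by (auto simp: X_def edge_def)
  then show thesis by (rule that)
qed

section \<open>Eigenvectors\<close>

lemma continuous_on_det [continuous_intros]:
  fixes f :: "'a::topological_space \<Rightarrow> complex^'n^'n"
  shows "continuous_on S f \<Longrightarrow> continuous_on S (\<lambda>x. det (f x))"
  unfolding det_def by (intro continuous_intros)

lemma diag_mult:
  fixes Y :: "complex^'m^'n"
  shows "(\<chi> i j. if i = j then t i else 0) ** Y = (\<chi> i j. t i * Y $ i $ j)"
  by (simp add: matrix_matrix_mult_def vec_eq_iff if_distrib[of "\<lambda>c. c * _"] cong: if_cong)

lemma diag_mult_vec:
  fixes y :: "complex^'n"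
  shows "(\<chi> i j. if i = j then t i else 0) *v y = (\<chi> i. t i * y $ i)"
  by (simp add: matrix_vector_mult_def vec_eq_iff if_distrib[of "\<lambda>c. c * _"] cong: if_cong)

lemma det_eq_0_kernel:
  fixes A :: "complex^'n^'n"
  assumes "det A = 0"
  obtains z where "z \<noteq> 0" "A *v z = 0"
  using assms invertible_det_nz[of A] matrix_left_invertible_ker[of A] invertible_left_inverse[of A]
  by blast

text \<open>Controls \<open>det (D - M)\<close> for a large diagonal \<open>D\<close>: pulling out
  \<open>D\<close> leaves \<open>det (mat 1 - X)\<close> with \<open>X\<close> small.\<close>

lemma det_near_1:
  "\<exists>d > 0. \<forall>X :: complex^'n^'n. norm X < d \<longrightarrow> cmod (det (mat 1 - X) - 1) < 1 / 2"
proof -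
  have "continuous_on UNIV (\<lambda>X :: complex^'n^'n. det (mat 1 - X))"
    by (intro continuous_intros)
  then have "isCont (\<lambda>X :: complex^'n^'n. det (mat 1 - X)) 0"
    by (simp add: continuous_on_eq_continuous_at)
  then obtain d where "d > 0"
    "\<forall>X :: complex^'n^'n. dist X 0 < d \<longrightarrow> dist (det (mat 1 - X)) (det (mat 1 - 0 :: complex^'n^'n)) < 1 / 2"
    unfolding continuous_at_eps_delta by (meson half_gt_zero zero_less_one)
  then show ?thesis by (auto simp: dist_norm)
qed

lemma norm_matrix_le_sum:
  fixes A :: "complex^'n^'m"
  shows "norm A \<le> (\<Sum>i\<in>UNIV. \<Sum>j\<in>UNIV. norm (A $ i $ j))"
proof -
  have "norm A \<le> (\<Sum>i\<in>UNIV. norm (A $ i))"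
    by (simp add: norm_vec_def L2_set_le_sum)
  also have "\<dots> \<le> (\<Sum>i\<in>UNIV. \<Sum>j\<in>UNIV. norm (A $ i $ j))"
    by (intro sum_mono) (simp add: norm_vec_def L2_set_le_sum)
  finally show ?thesis .
qed

text \<open>The fundamental theorem of algebra for the characteristic polynomial, taken as a
  determinant over the polynomial ring. That it is not constant follows from its growth at a large
  real argument.\<close>

lemma eigenvector_exists:
  fixes A :: "complex^'n^'n"
  obtains c z where "z \<noteq> 0" "A *v z = c *s z"
proof -
  define p where "p = det (\<chi> i j. if i = j then [:A $ i $ j, - 1:] else [:A $ i $ j:])"
  have p: "poly p c = det (A - mat c)" for c
    unfolding p_def det_def
    by (auto simp: poly_sum poly_prod mat_def if_distrib intro!: sum.cong prod.cong)
  have "\<not> constant (poly p)"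
  proof
    assume const: "constant (poly p)"
    define K where "K = (\<Sum>i\<in>UNIV. \<Sum>j\<in>UNIV. norm (A $ i $ j))"
    obtain d where d: "d > 0"
      "\<And>X :: complex^'n^'n. norm X < d \<Longrightarrow> cmod (det (mat 1 - X) - 1) < 1 / 2"
      using det_near_1[where 'n = 'n] by blast
    \<comment> \<open>The first term of the maximum makes the norm of \<open>A\<close> divided by
      \<open>R\<close> smaller than \<open>d\<close>; the second makes \<open>R / 2\<close> exceed
      the modulus of \<open>poly p 0\<close>.\<close>
    define R where "R = max (K / d) (2 * cmod (poly p 0)) + 1"
    have "K \<ge> 0" by (simp add: K_def sum_nonneg)
    have "K / d < R" "2 * cmod (poly p 0) < R" "R \<ge> 1"
      using d(1) \<open>K \<ge> 0\<close> by (auto simp: R_def max_def)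
    then have R: "R \<ge> 1" "K / R < d" "2 * cmod (poly p 0) < R"
      using d(1) by (auto simp: field_simps)
    define c where "c = complex_of_real R"
    define X where "X = (\<chi> i j. A $ i $ j / c)"
    have c: "c \<noteq> 0" "cmod c = R" using R by (auto simp: c_def)
    have "norm X \<le> (\<Sum>i\<in>UNIV. \<Sum>j\<in>UNIV. norm (X $ i $ j))" by (rule norm_matrix_le_sum)
    also have "\<dots> = K / R" by (simp add: X_def K_def norm_divide c sum_divide_distrib)
    finally have "norm X < d" using R by simp
    then have h: "cmod (det (mat 1 - X) - 1) < 1 / 2" by (rule d(2))
    have "A - mat c = mat (- c) ** (mat 1 - X)"
      unfolding mat_def[of "- c"] diag_mult using c by (simp add: vec_eq_iff X_def mat_def algebra_simps)
    then have "poly p c = det (mat (- c) :: complex^'n^'n) * det (mat 1 - X)"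
      by (simp add: p det_mul)
    also have "det (mat (- c) :: complex^'n^'n) = (- c) ^ CARD('n)"
      by (subst det_diagonal) (auto simp: mat_def)
    finally have "cmod (poly p c) = R ^ CARD('n) * cmod (det (mat 1 - X))"
      by (simp add: norm_mult norm_power c)
    moreover have h2: "cmod (det (mat 1 - X)) > 1 / 2"
      using h norm_triangle_ineq2[of 1 "1 - det (mat 1 - X)"] by (simp add: norm_minus_commute)
    moreover have Rn: "R ^ CARD('n) \<ge> R ^ 1"
      using R(1) by (intro power_increasing) auto
    ultimately have "cmod (poly p c) \<ge> R * (1 / 2)"
      using mult_mono[OF Rn, of "1 / 2" "cmod (det (mat 1 - X))"] h2 R(1) by simp
    moreover have "poly p c = poly p 0" using const by (metis constant_def)
    ultimately show False using R(3) by simp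
  qed
  then obtain c where "poly p c = 0"
    using fundamental_theorem_of_algebra by blast
  then have "det (A - mat c) = 0" by (simp add: p)
  then obtain z where z: "z \<noteq> 0" "(A - mat c) *v z = 0" by (rule det_eq_0_kernel)
  have "mat c *v z = c *s z"
    by (simp add: mat_def diag_mult_vec vec_eq_iff)
  with z that show thesis by (metis eq_iff_diff_eq_0 matrix_vector_mult_diff_rdistrib)
qed

text \<open>Normality gives \<open>adj A *v z\<close> and \<open>A *v z\<close> the same norm, and
  then the squared norm of \<open>adj A *v z - cnj c *s z\<close> expands to 0.\<close>

lemma normal_eigenvector:
  fixes A :: "complex^'n^'n"
  assumes "A ** adj A = adj A ** A"
  obtains c z where "z \<noteq> 0" "A *v z = c *s z" "adj A *v z = cnj c *s z"
proof -
  obtain c z where z: "z \<noteq> 0" "A *v z = c *s z" by (rule eigenvector_exists)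
  have "hip (adj A *v z) (adj A *v z) = hip (A *v z) (A *v z)"
    by (simp add: hip_adj' matrix_vector_mul_assoc assms)
  moreover have "hip z (adj A *v z) = cnj c * hip z z" "hip (adj A *v z) z = c * hip z z"
    using z by (simp_all add: hip_adj'[symmetric] hip_adj[symmetric] hip_linear)
  ultimately have "hip (adj A *v z - cnj c *s z) (adj A *v z - cnj c *s z) = 0"
    using z by (simp add: hip_linear)
  then have "adj A *v z = cnj c *s z" by simp
  with z that show thesis by blast
qed

text \<open>The residual \<open>v - k *s u\<close> of the orthogonal projection of \<open>v\<close>
  to \<open>u\<close> is nonzero, which makes Cauchy-Schwarz strict.\<close>

lemma hip_CS_strict:
  assumes "norm u = norm v" "\<And>k. v \<noteq> k *s u" "u \<noteq> 0"
  shows "cmod (hip u v) < (norm u)\<^sup>2"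
proof -
  define k where "k = hip u v / of_real ((norm u)\<^sup>2)"
  have u: "hip u u = of_real ((norm u)\<^sup>2)" "hip v v = of_real ((norm u)\<^sup>2)"
    using assms by (simp_all add: hip_self)
  have "k * hip u u = hip u v" using assms by (simp add: k_def hip_self)
  then have "hip (v - k *s u) (v - k *s u) = hip v v - hip u v * hip v u / of_real ((norm u)\<^sup>2)"
    using u by (simp add: hip_linear k_def cnj_hip algebra_simps)
  also have "\<dots> = of_real ((norm u)\<^sup>2 - (cmod (hip u v))\<^sup>2 / (norm u)\<^sup>2)"
    by (simp add: hip_mult_hip u del: of_real_power)
  finally have "(norm (v - k *s u))\<^sup>2 = (norm u)\<^sup>2 - (cmod (hip u v))\<^sup>2 / (norm u)\<^sup>2"
    unfolding hip_self of_real_eq_iff .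
  moreover have "norm (v - k *s u) \<noteq> 0" using assms(2)[of k] by simp
  ultimately have "(cmod (hip u v))\<^sup>2 / (norm u)\<^sup>2 < (norm u)\<^sup>2"
    by (metis diff_gt_0_iff_gt zero_less_power2)
  then have "(cmod (hip u v))\<^sup>2 < ((norm u)\<^sup>2)\<^sup>2"
    using assms(3) by (simp add: field_simps power2_eq_square[of "(norm u)\<^sup>2"])
  then show ?thesis by (rule power2_less_imp_less) simp
qed

text \<open>The determinant is not holomorphic in \<alpha>, so a topological argument replaces the
  fundamental theorem of algebra. In size 3 the leading term is \<alpha> times its squared modulus,
  of winding number 1; in size 2 it would be the squared modulus alone, of winding number 0.\<close>

lemma twisted_eigenvector:
  fixes M :: "complex^'n^'n"
  assumes "CARD('n) = 3"
  shows "\<exists>\<alpha> z. z \<noteq> 0 \<and> (\<forall>i. (M *v z) $ i = (if i = i0 then cnj \<alpha> else \<alpha>) * z $ i)"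
proof -
  define t where "t = (\<lambda>\<alpha> i. if i = i0 then cnj \<alpha> else \<alpha>)"
  define D :: "complex \<Rightarrow> complex^'n^'n" where "D = (\<lambda>\<alpha>. \<chi> i j. if i = j then t \<alpha> i else 0)"
  define g where "g = (\<lambda>\<alpha>. det (D \<alpha> - M))"
  have "\<exists>\<alpha>. g \<alpha> = 0"
  proof (rule ccontr)
    assume nz: "\<nexists>\<alpha>. g \<alpha> = 0"
    have "continuous_on UNIV (\<lambda>\<alpha>. if i = j then t \<alpha> i else 0)" for i j
      by (cases "i = j"; cases "i = i0") (auto simp: t_def intro!: continuous_on_cnj continuous_on_id)
    then have contg: "continuous_on UNIV g"
      unfolding g_def D_def by (intro continuous_intros)
    define K where "K = (\<Sum>i\<in>UNIV. \<Sum>j\<in>UNIV. norm (M $ i $ j))"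
    obtain d where d: "d > 0"
      "\<And>X :: complex^'n^'n. norm X < d \<Longrightarrow> cmod (det (mat 1 - X) - 1) < 1 / 2"
      using det_near_1[where 'n = 'n] by blast
    define R where "R = K / d + 1"
    have "K \<ge> 0" by (simp add: K_def sum_nonneg)
    then have R: "R > 0" "K / R < d" using d(1) by (simp_all add: R_def field_simps add_pos_nonneg)
    \<comment> \<open>Without a zero of \<open>g\<close>, this maps the disc into its boundary
      circle, pointing opposite to \<open>g\<close>. On the circle
      \<open>g \<alpha> / \<alpha>\<close> has positive real part, which a fixed point would
      contradict.\<close>
    define f where "f = (\<lambda>\<alpha>. - (of_real R * g \<alpha> / of_real (cmod (g \<alpha>))))"
    have "continuous_on (cball 0 R) f"
      unfolding f_def using nz by (intro continuous_intros continuous_on_subset[OF contg]) auto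
    moreover have nf: "cmod (f \<alpha>) = R" for \<alpha>
      using nz R by (simp add: f_def norm_mult norm_divide)
    ultimately obtain \<alpha> where \<alpha>: "f \<alpha> = \<alpha>"
      using brouwer[of "cball 0 R" f] R by auto
    with nf have n\<alpha>: "cmod \<alpha> = R" by metis
    define X where "X = (\<chi> i j. M $ i $ j / t \<alpha> i)"
    have nt: "cmod (t \<alpha> i) = R" for i using n\<alpha> by (simp add: t_def)
    have "norm X \<le> (\<Sum>i\<in>UNIV. \<Sum>j\<in>UNIV. norm (X $ i $ j))" by (rule norm_matrix_le_sum)
    also have "\<dots> = K / R" by (simp add: X_def K_def norm_divide nt sum_divide_distrib)
    finally have "norm X < d" using R by simp
    then have h: "cmod (det (mat 1 - X) - 1) < 1 / 2" by (rule d(2))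
    define h where "h = det (mat 1 - X)"
    have "Re h > 0" using h abs_Re_le_cmod[of "h - 1"] by (simp add: h_def)
    have t0: "t \<alpha> i \<noteq> 0" for i using nt[of i] R by auto
    have "D \<alpha> - M = D \<alpha> ** (mat 1 - X)"
      unfolding D_def diag_mult using t0 by (simp add: vec_eq_iff X_def mat_def algebra_simps)
    then have "g \<alpha> = det (D \<alpha>) * h" by (simp add: g_def h_def det_mul)
    also have "det (D \<alpha>) = (\<Prod>i\<in>UNIV. t \<alpha> i)"
      by (subst det_diagonal) (auto simp: D_def)
    also have "\<dots> = cnj \<alpha> * (\<Prod>i\<in>UNIV - {i0}. t \<alpha> i)"
      by (subst prod.remove[of _ i0]) (auto simp: t_def)
    also have "(\<Prod>i\<in>UNIV - {i0}. t \<alpha> i) = \<alpha>\<^sup>2"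
      using assms by (simp add: t_def card_Diff_singleton)
    also have "cnj \<alpha> * \<alpha>\<^sup>2 = of_real (R\<^sup>2) * \<alpha>"
      using n\<alpha> by (metis complex_norm_square mult.assoc mult.commute power2_eq_square)
    finally have g: "g \<alpha> = of_real (R\<^sup>2) * \<alpha> * h" .
    \<comment> \<open>The positive factor for which \<open>f \<alpha> = \<alpha>\<close> reads
      \<open>\<alpha> * (1 + of_real r * h) = 0\<close>.\<close>
    define r where "r = R * R\<^sup>2 / cmod (g \<alpha>)"
    have "\<alpha> * (1 + of_real r * h) = 0"
    proof -
      have "f \<alpha> = - (of_real r * h * \<alpha>)"
        unfolding f_def r_def by (subst (1) g) simp
      then have "of_real r * h * \<alpha> = - f \<alpha>" by simp
      then have "of_real r * h * \<alpha> = - \<alpha>" by (simp only: \<alpha>)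
      moreover have "\<alpha> * (1 + of_real r * h) = \<alpha> + of_real r * h * \<alpha>"
        by (simp add: algebra_simps)
      ultimately show ?thesis by simp
    qed
    then have "1 + of_real r * h = 0"
      using n\<alpha> R by auto
    then have "1 + r * Re h = 0"
      by (simp add: complex_eq_iff)
    moreover have "r * Re h > 0"
      unfolding r_def using R \<open>Re h > 0\<close> nz by simp
    ultimately show False by simp
  qed
  then obtain \<alpha> where "det (D \<alpha> - M) = 0" by (auto simp: g_def)
  then obtain z where z: "z \<noteq> 0" "(D \<alpha> - M) *v z = 0" by (rule det_eq_0_kernel)
  have "(D \<alpha> *v z) $ i = t \<alpha> i * z $ i" for i
    by (simp add: D_def diag_mult_vec)
  moreover have "D \<alpha> *v z = M *v z"
    using z(2) by (simp add: matrix_vector_mult_diff_rdistrib)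
  ultimately show ?thesis
    using z(1) unfolding t_def by metis
qed

text \<open>Cayley-Hamilton in size 3, checked by coordinates: \<open>c2\<close> is the trace,
  \<open>- c1\<close> the sum of the principal 2 by 2 minors, \<open>c0\<close> the
  determinant.\<close>

lemma cubic_relation:
  fixes M :: "complex^'n^'n"
  assumes "CARD('n) = 3"
  shows "\<exists>c0 c1 c2. \<forall>x. M *v (M *v (M *v x)) = c2 *s (M *v (M *v x)) + c1 *s (M *v x) + c0 *s x"
proof -
  obtain i j k where U: "(UNIV :: 'n set) = {i, j, k}" and ne: "i \<noteq> j" "i \<noteq> k" "j \<noteq> k"
    using assms by (metis card_3_iff)
  have sum3: "(\<Sum>l\<in>UNIV. f l) = f i + f j + f k" for f :: "'n \<Rightarrow> complex"
    unfolding U using ne by simp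
  define c2 where "c2 = M$i$i + M$j$j + M$k$k"
  define c1 where "c1 = M$i$j * M$j$i + M$i$k * M$k$i + M$j$k * M$k$j
    - M$i$i * M$j$j - M$i$i * M$k$k - M$j$j * M$k$k"
  define c0 where "c0 = M$i$i * (M$j$j * M$k$k - M$j$k * M$k$j)
    - M$i$j * (M$j$i * M$k$k - M$j$k * M$k$i) + M$i$k * (M$j$i * M$k$j - M$j$j * M$k$i)"
  have "M *v (M *v (M *v x)) = c2 *s (M *v (M *v x)) + c1 *s (M *v x) + c0 *s x" for x
  proof (unfold vec_eq_iff, rule allI)
    fix l
    have "l \<in> {i, j, k}" using U by blast
    then show "(M *v (M *v (M *v x))) $ l = (c2 *s (M *v (M *v x)) + c1 *s (M *v x) + c0 *s x) $ l"
      unfolding c0_def c1_def c2_def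
      by (auto simp: matrix_vector_mult_def sum3 algebra_simps)
  qed
  then show ?thesis by blast
qed

section \<open>Self-commutators of rank at most two\<close>

text \<open>Independence of the family rather than of the set \<open>{u, v}\<close>, so that
  \<open>u = v\<close> is excluded.\<close>

definition indep2 :: "complex^'n \<Rightarrow> complex^'n \<Rightarrow> bool"
  where "indep2 u v \<longleftrightarrow> (\<forall>a b. a *s u + b *s v = 0 \<longrightarrow> a = 0 \<and> b = 0)"

lemma span1: "x \<in> vec.span {u} \<longleftrightarrow> (\<exists>a. x = a *s (u :: complex^'n))"
  by (auto simp: vec.span_insert)

lemma span2: "x \<in> vec.span {u, v} \<longleftrightarrow> (\<exists>a b. x = a *s u + b *s (v :: complex^'n))"
  by (auto simp: vec.span_insert[of u] span1 algebra_simps)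

lemma span3: "x \<in> vec.span {u, v, w} \<longleftrightarrow> (\<exists>a b c. x = a *s u + b *s v + c *s (w :: complex^'n))"
  by (auto simp: vec.span_insert[of u "{v, w}"] span2 algebra_simps)

lemma indep2_nonzero:
  assumes "indep2 u v"
  shows "u \<noteq> 0" "v \<noteq> 0"
proof -
  show "u \<noteq> 0"
  proof
    assume "u = 0"
    then have "1 *s u + 0 *s v = 0" by simp
    then show False using assms unfolding indep2_def by (metis zero_neq_one)
  qed
  show "v \<noteq> 0"
  proof
    assume "v = 0"
    then have "0 *s u + 1 *s v = 0" by simp
    then show False using assms unfolding indep2_def by (metis zero_neq_one)
  qed
qed

lemma indep2_independent:
  assumes "indep2 u v"
  shows "vec.independent {u, v}" "card {u, v} = 2"
proof -
  have "v \<noteq> 0" by (rule indep2_nonzero[OF assms])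
  moreover have "u \<notin> vec.span {v}"
  proof
    assume "u \<in> vec.span {v}"
    then obtain a where "u = a *s v" by (auto simp: span1)
    then have "1 *s u + (- a) *s v = 0" by simp
    then show False using assms unfolding indep2_def by (metis zero_neq_one)
  qed
  ultimately show "vec.independent {u, v}" "card {u, v} = 2"
    by (auto simp: vec.independent_insert span1 card_insert_if)
      (metis vec.scale_one)
qed

lemma indep2_spans:
  fixes u v :: "complex^'n"
  assumes "indep2 u v" "CARD('n) \<le> 2"
  obtains a b where "x = a *s u + b *s v"
proof -
  have "UNIV \<subseteq> vec.span {u, v}"
    using indep2_independent[OF assms(1)] assms(2)
    by (intro vec.card_ge_dim_independent) (auto simp: card_cart_basis)
  then show thesis using that by (metis UNIV_I span2 subsetD)
qed

lemma indep3_spans: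
  fixes u v :: "complex^'n"
  assumes "indep2 u v" "\<And>a b. w \<noteq> a *s u + b *s v" "CARD('n) \<le> 3"
  obtains a b c where "x = a *s u + b *s v + c *s w"
proof -
  have w: "w \<notin> vec.span {u, v}" using assms(2) by (simp add: span2)
  then have "vec.independent {w, u, v}"
    using indep2_independent[OF assms(1)] by (simp add: vec.independent_insertI)
  moreover have "card {w, u, v} = 3"
    using indep2_independent[OF assms(1)] w vec.span_base[of w "{u, v}"]
    by (metis card_insert_disjoint finite.emptyI finite.insertI Suc_eq_plus1 numeral_2_eq_2 numeral_3_eq_3)
  ultimately have "UNIV \<subseteq> vec.span {w, u, v}"
    using assms(3) by (intro vec.card_ge_dim_independent) (auto simp: card_cart_basis)
  then have "x \<in> vec.span {u, v, w}" by (metis UNIV_I insert_commute subsetD)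
  then show thesis using that by (auto simp: span3)
qed

lemma inner_vec_hip: "inner x y = Re (hip x (y :: complex^'n))"
  by (simp add: inner_vec_def hip_def inner_complex_def)

text \<open>The case \<open>e = 0\<close> occurs in dimension 2.\<close>

lemma orth_complement_exists:
  fixes u v :: "complex^'n"
  assumes uv: "indep2 u v" and n: "CARD('n) \<le> 3"
  obtains e where "hip e u = 0" "hip e v = 0" "e = 0 \<or> hip e e = 1 \<and> CARD('n) = 3"
    "\<And>x. hip e x = 0 \<Longrightarrow> \<exists>a b. x = a *s u + b *s v"
proof (cases "CARD('n) \<le> 2")
  case True
  with uv show thesis using that[of 0] by (metis hip_zero_left indep2_spans)
next
  case False
  with n have n3: "CARD('n) = 3" by simp
  \<comment> \<open>Real orthogonality to \<open>u\<close> and \<open>\<i> *s u\<close> together is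
    complex orthogonality to \<open>u\<close>. Four real vectors leave room in real dimension
    6.\<close>
  let ?S = "{u, \<i> *s u, v, \<i> *s v}"
  have "dim ?S \<le> card ?S" by (rule dim_le_card') simp
  also have "\<dots> \<le> 4" by (intro card_insert_le_m1) auto
  also have "4 < DIM(complex^'n)" using n3 by simp
  finally obtain e where e: "e \<noteq> 0" "\<And>y. y \<in> span ?S \<Longrightarrow> orthogonal e y"
    by (rule orthogonal_to_subspace_exists) blast
  then have "orthogonal e u" "orthogonal e (\<i> *s u)" "orthogonal e v" "orthogonal e (\<i> *s v)"
    by (auto simp: span_base)
  then have uv0: "hip e u = 0" "hip e v = 0"
    by (auto simp: orthogonal_def inner_vec_hip hip_linear complex_eq_iff)
  define f where "f = of_real (1 / norm e) *s e"
  have "hip f f = of_real (1 / norm e) * of_real (1 / norm e) * hip e e"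
    by (simp add: f_def hip_linear)
  then have f: "hip f u = 0" "hip f v = 0" "hip f f = 1"
    using e(1) uv0 by (simp_all add: f_def hip_linear hip_self power2_eq_square)
  have "f \<noteq> a *s u + b *s v" for a b
    using f by (metis add_0 hip_add_right hip_scale_right mult_zero_right zero_neq_one)
  then have "\<exists>a b. x = a *s u + b *s v" if "hip f x = 0" for x
  proof -
    obtain a b c where x: "x = a *s u + b *s v + c *s f"
      using \<open>\<And>a b. f \<noteq> a *s u + b *s v\<close> indep3_spans[OF uv _ n, of f x] by metis
    then have "c = 0" using f that by (simp add: hip_linear)
    with x show ?thesis by auto
  qed
  with f n3 that show thesis by blast
qed

section \<open>Trace identities for self-commutators\<close>

lemma trace_outer: "trace (outer u) = hip u u"
  by (simp add: trace_def outer_def hip_def mult.commute)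

lemma trace_mult_outer: "trace (A ** outer u) = hip u (A *v u)"
proof -
  have "trace (A ** outer u) = (\<Sum>i\<in>UNIV. \<Sum>j\<in>UNIV. A $ i $ j * (u $ j * cnj (u $ i)))"
    by (simp add: trace_def outer_def matrix_matrix_mult_def)
  also have "\<dots> = hip u (A *v u)"
    by (simp add: hip_def matrix_vector_mult_def sum_distrib_left mult_ac)
  finally show ?thesis .
qed

text \<open>
  \<open>hip f (p(M) N e) = hip f (N p(M) e)\<close> for polynomials \<open>p\<close> of degree at most 2, and the cubic
  relation extends this to degree 3.
\<close>

lemma commutator_pairing:
  fixes M N :: "complex^'n^'n"
  assumes n: "CARD('n) = 3"
    and e: "M *v (N *v e) = N *v (M *v e)"
    and f: "\<And>x. hip f (M *v (N *v x)) = hip f (N *v (M *v x))"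
  shows "hip f (M *v (M *v (N *v (M *v e)))) = hip f (M *v (N *v (M *v (M *v e))))"
proof -
  obtain c0 c1 c2 where c: "\<And>x. M *v (M *v (M *v x)) = c2 *s (M *v (M *v x)) + c1 *s (M *v x) + c0 *s x"
    using cubic_relation[OF n, of M] by blast
  have "hip f (M *v (M *v (N *v (M *v e)))) = hip f (M *v (M *v (M *v (N *v e))))"
    by (simp add: e)
  also have "\<dots> = c2 * hip f (M *v (M *v (N *v e))) + c1 * hip f (M *v (N *v e)) + c0 * hip f (N *v e)"
    by (simp only: c hip_linear)
  also have "\<dots> = hip f (N *v (M *v (M *v (M *v e))))"
    by (simp add: c mult_vec_linear hip_linear f e)
  also have "\<dots> = hip f (M *v (N *v (M *v (M *v e))))"
    by (simp add: f)
  finally show ?thesis .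
qed

lemma commutator_outer:
  fixes B :: "complex^'n^'n"
  assumes "B ** adj B - adj B ** B = outer u - outer v"
  shows "B *v (adj B *v x) - adj B *v (B *v x) = hip u x *s u - hip v x *s v"
proof -
  have "(B ** adj B - adj B ** B) *v x = (outer u - outer v) *v x" by (simp add: assms)
  then show ?thesis
    by (simp add: matrix_vector_mult_diff_rdistrib matrix_vector_mul_assoc outer_mult_vec)
qed

lemma commutator_outer_norm:
  fixes B :: "complex^'n^'n"
  assumes "B ** adj B - adj B ** B = outer u - outer v"
  shows "norm u = norm v"
proof -
  have "trace (B ** adj B - adj B ** B) = 0"
    by (simp add: trace_sub trace_mul_sym[of B "adj B"])
  then have "hip u u = hip v v" by (simp add: assms trace_sub trace_outer)
  then have "(norm u)\<^sup>2 = (norm v)\<^sup>2" unfolding hip_self of_real_eq_iff .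
  then show ?thesis by simp
qed

text \<open>The trace of \<open>B\<close> times its self-commutator vanishes by cyclicity.\<close>

lemma commutator_outer_form:
  fixes B :: "complex^'n^'n"
  assumes "B ** adj B - adj B ** B = outer u - outer v"
  shows "hip u (B *v u) = hip v (B *v v)"
proof -
  have "B ** adj B + outer v = adj B ** B + outer u"
    using assms by (simp add: algebra_simps)
  then have "trace (B ** (B ** adj B)) + trace (B ** outer v)
      = trace (B ** (adj B ** B)) + trace (B ** outer u)"
    unfolding trace_add[symmetric] matrix_add_ldistrib[symmetric] by simp
  moreover have "trace (B ** (B ** adj B)) = trace (B ** (adj B ** B))"
    using trace_mul_sym[of B "B ** adj B"] by (simp add: matrix_mul_assoc)
  ultimately show ?thesis by (simp add: trace_mult_outer)
qed

text \<open>Replacing \<open>u\<close> by \<open>w *s u\<close> does not change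
  \<open>outer u\<close>; the phase prepares the third assumption of
  \<open>normal_dilation_eigenvector\<close>. Only the component along \<open>e\<close>, orthogonal
  to \<open>u\<close> and \<open>v\<close>, matters, so the claim is that \<open>p\<close> and
  \<open>q'\<close> have equal modulus.\<close>

lemma phase_exists:
  fixes B :: "complex^'n^'n"
  assumes n: "CARD('n) \<le> 3" and uv: "indep2 u v"
    and B: "B ** adj B - adj B ** B = outer u - outer v"
  obtains w c d where "cmod w = 1" "w *s (B *v u) - adj B *v v = c *s u + d *s v"
proof -
  obtain e where e: "hip e u = 0" "hip e v = 0" "e = 0 \<or> hip e e = 1 \<and> CARD('n) = 3"
    and sp: "\<And>x. hip e x = 0 \<Longrightarrow> \<exists>a b. x = a *s u + b *s v"
    by (rule orth_complement_exists[OF uv n]) blast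
  define p p' q q' where "p = hip e (B *v u)" and "p' = hip e (adj B *v u)"
    and "q = hip e (B *v v)" and "q' = hip e (adj B *v v)"
  have "cmod p = cmod q'"
  proof (cases "e = 0")
    case True
    then show ?thesis by (simp add: p_def q'_def)
  next
    case False
    with e have ee: "hip e e = 1" and n3: "CARD('n) = 3" by auto
    have Ie: "hip u e = 0" "hip v e = 0"
      using cnj_hip[of e u] cnj_hip[of e v] e by simp_all
    note X = commutator_outer[OF B]
    have Xe: "B *v (adj B *v e) = adj B *v (B *v e)" using X[of e] Ie by simp
    have Xf: "hip e (B *v (adj B *v x)) = hip e (adj B *v (B *v x))" for x
    proof -
      have "hip e (B *v (adj B *v x) - adj B *v (B *v x)) = 0"
        unfolding X by (simp add: hip_linear e)
      then show ?thesis by (simp add: hip_linear)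
    qed
    \<comment> \<open>\<open>commutator_pairing\<close> for \<open>B + k *\<close>
      \<open>adj B\<close> and \<open>adj B\<close>, whose commutator is again
      \<open>outer u - outer v\<close>. The free \<open>k\<close> makes one identity yield several
      relations.\<close>
    have pairing: "hip e (B *v (hip u y *s u - hip v y *s v)) + k * hip e (adj B *v (hip u y *s u - hip v y *s v)) = 0"
      if y: "y = B *v e + k *s (adj B *v e)" for k y
    proof -
      define M where "M = B + (mat k ** adj B)"
      have M: "M *v x = B *v x + k *s (adj B *v x)" for x
        by (simp add: M_def matrix_vector_mult_add_rdistrib flip: matrix_vector_mul_assoc)
           (simp add: mat_def diag_mult_vec vec_eq_iff)
      have "hip e (M *v (M *v (adj B *v (M *v e)))) = hip e (M *v (adj B *v (M *v (M *v e))))"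
        by (rule commutator_pairing[OF n3]) (simp_all add: M mult_vec_linear hip_linear Xe Xf)
      then have "hip e (M *v (M *v (adj B *v y))) = hip e (M *v (adj B *v (M *v y)))"
        by (simp only: M y)
      moreover have XM: "M *v (adj B *v y) - adj B *v (M *v y) = hip u y *s u - hip v y *s v"
        by (simp add: M mult_vec_linear flip: X)
      ultimately have "hip e (M *v (hip u y *s u - hip v y *s v)) = 0"
        unfolding XM[symmetric] by (simp add: mult_vec_linear hip_linear)
      then show ?thesis by (simp add: M hip_linear)
    qed
    have conj: "hip u (B *v e) = cnj p'" "hip u (adj B *v e) = cnj p"
      "hip v (B *v e) = cnj q'" "hip v (adj B *v e) = cnj q"
      by (simp_all add: p_def p'_def q_def q'_def cnj_hip hip_adj)
    have pair: "(cnj p' + k * cnj p) * (p + k * p') = (cnj q' + k * cnj q) * (q + k * q')" for k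
      using pairing[OF refl, of k]
      by (simp add: hip_linear mult_vec_linear conj p_def[symmetric] p'_def[symmetric]
          q_def[symmetric] q'_def[symmetric] algebra_simps)
    \<comment> \<open>\<open>R1\<close> and \<open>R2\<close> are the coefficients of 1 and
      \<open>k\<close>; the coefficient of the square of \<open>k\<close> is the conjugate of
      \<open>R1\<close>.\<close>
    have R1: "cnj p' * p = cnj q' * q" using pair[of 0] by simp
    have R2: "cnj p * p + cnj p' * p' = cnj q * q + cnj q' * q'"
    proof -
      have "cnj p * p' = cnj q * q'" using arg_cong[OF R1, of cnj] by (simp add: mult.commute)
      with R1 pair[of 1] show ?thesis by (simp add: distrib_left distrib_right)
    qed
    have R1': "cmod p' * cmod p = cmod q' * cmod q"
      using arg_cong[OF R1, of cmod] by (simp add: norm_mult)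
    have "complex_of_real ((cmod p)\<^sup>2 + (cmod p')\<^sup>2) = of_real ((cmod q)\<^sup>2 + (cmod q')\<^sup>2)"
      using R2 unfolding of_real_add complex_norm_square by (simp add: mult.commute)
    then have R2': "(cmod p)\<^sup>2 + (cmod p')\<^sup>2 = (cmod q)\<^sup>2 + (cmod q')\<^sup>2"
      unfolding of_real_eq_iff .
    \<comment> \<open>The squared moduli of \<open>p, p'\<close> and of \<open>q, q'\<close> have
      the same sum and the same product, so they agree as unordered pairs.\<close>
    have "((cmod p)\<^sup>2 - (cmod q)\<^sup>2) * ((cmod p)\<^sup>2 - (cmod q')\<^sup>2) = 0"
    proof -
      have "(x - y) * (x - y') = 0" if "x' * x = y' * y" "x + x' = y + y'" for x x' y y' :: real
      proof -
        have "(x - y) * (x - y') = x * x - x * (y + y') + y' * y" by (simp add: algebra_simps)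
        also have "\<dots> = x * x - x * (x + x') + x' * x" by (simp only: that)
        finally show ?thesis by (simp add: algebra_simps)
      qed
      from this[OF _ R2'] show ?thesis
        using R1' by (simp flip: power_mult_distrib)
    qed
    then consider "cmod p = cmod q'" | "cmod p = cmod q" by auto
    then show ?thesis
    proof cases
      case 2
      \<comment> \<open>Now \<open>p'\<close> and \<open>q'\<close> have equal modulus, and
        \<open>p, p'\<close> must be compared. The parts \<open>a\<close>, \<open>b\<close> of
        \<open>B *v e\<close> and \<open>adj B *v e\<close> orthogonal to \<open>e\<close> have
        equal norm, as \<open>B\<close> and \<open>adj B\<close> commute at \<open>e\<close>. Their
        inner products with \<open>u\<close> and \<open>v\<close> determine them and are
        proportional, so if \<open>p\<close> is nonzero then \<open>a = m *s b\<close> with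
        \<open>m\<close> of modulus 1.\<close>
      define a b where "a = B *v e - hip e (B *v e) *s e" and "b = adj B *v e - hip e (adj B *v e) *s e"
      have ab: "hip e a = 0" "hip e b = 0" by (simp_all add: a_def b_def hip_linear ee)
      have uvab: "hip u a = cnj p'" "hip u b = cnj p" "hip v a = cnj q'" "hip v b = cnj q"
        by (simp_all add: a_def b_def hip_linear conj Ie)
      have zero: "z = 0" if z: "hip e z = 0" "hip u z = 0" "hip v z = 0" for z
      proof -
        obtain c d where "z = c *s u + d *s v" using sp[OF z(1)] by blast
        then have "hip z z = hip (c *s u + d *s v) z" by simp
        then have "hip z z = 0" using z by (simp add: hip_linear)
        then show ?thesis by simp
      qed
      have cc: "hip e (adj B *v e) = cnj (hip e (B *v e))" "hip (B *v e) e = cnj (hip e (B *v e))"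
        "hip (adj B *v e) e = hip e (B *v e)"
        by (simp_all add: cnj_hip hip_adj)
      have "hip (B *v e) (B *v e) = hip (adj B *v e) (adj B *v e)"
        unfolding hip_adj' using Xe by simp
      then have naeqb: "hip a a = hip b b"
        by (simp add: a_def b_def hip_linear ee cc)
      have "cmod p' = cmod p"
      proof (cases "p = 0")
        case True
        with 2 have "q = 0" by simp
        with True have "b = 0" by (intro zero) (simp_all add: ab uvab)
        with naeqb have "a = 0" by simp
        with uvab True show ?thesis by simp
      next
        case False
        define m where "m = cnj p' / cnj p"
        have "p' * cnj p = q' * cnj q" using arg_cong[OF R1, of cnj] by (simp add: mult.commute)
        moreover have "p * cnj p = q * cnj q"
          using 2 by (metis complex_norm_square)
        ultimately have "(p' * q) * cnj p = (p * q') * cnj p"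
          by (metis mult.assoc mult.commute)
        then have "p' * q = p * q'" using False by simp
        from arg_cong[OF this, of cnj] have "m * cnj q = cnj q'" using False by (simp add: m_def field_simps)
        moreover have "m * cnj p = cnj p'" using False by (simp add: m_def)
        ultimately have "a - m *s b = 0" by (intro zero) (simp_all add: hip_linear ab uvab)
        then have am: "a = m *s b" by simp
        then have "hip b b = of_real ((cmod m)\<^sup>2) * hip b b"
          using naeqb unfolding complex_norm_square by (simp add: hip_linear mult_ac)
        moreover have "hip b b \<noteq> 0" using uvab False by auto
        ultimately have "complex_of_real ((cmod m)\<^sup>2) = of_real 1" by simp
        then have "(cmod m)\<^sup>2 = 1" unfolding of_real_eq_iff .
        then have "cmod m = 1" by (simp add: power2_eq_1_iff) (smt (verit) norm_ge_zero)
        then show ?thesis using False by (simp add: m_def norm_divide)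
      qed
      with 2 R2' have "(cmod p)\<^sup>2 = (cmod q')\<^sup>2" by simp
      then show ?thesis by simp
    qed
  qed
  \<comment> \<open>The quotient \<open>q' / p\<close>, or 1 if both vanish.\<close>
  then obtain w where w: "cmod w = 1" "w * p = q'"
  proof (cases "p = 0")
    case True
    with \<open>cmod p = cmod q'\<close> show thesis using that[of 1] by simp
  next
    case False
    with \<open>cmod p = cmod q'\<close> have "cmod (q' / p) = 1"
      by (metis divide_self norm_divide norm_eq_zero)
    with False show thesis by (intro that[of "q' / p"]) (simp_all del: norm_divide)
  qed
  have "hip e (w *s (B *v u) - adj B *v v) = 0"
    unfolding hip_linear p_def[symmetric] q'_def[symmetric] w(2) by simp
  from sp[OF this] obtain c d where "w *s (B *v u) - adj B *v v = c *s u + d *s v"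
    by blast
  then show thesis using that[OF w(1)] by simp
qed

section \<open>Bordering a matrix to a normal one\<close>

lemma sum_option: "(\<Sum>i\<in>(UNIV :: 'n::finite option set). f i) = f None + (\<Sum>k\<in>UNIV. f (Some k))"
  by (simp add: UNIV_option_conv sum.reindex)

text \<open>
  Comparing the inner products of the third assumption with \<open>u\<close> and \<open>v\<close> gives \<open>d = - cnj c\<close>, and
  this makes \<open>B\<close> bordered by \<open>v\<close>, \<open>u\<^sup>*\<close> and \<open>c\<close> a normal matrix.
\<close>

lemma normal_dilation_eigenvector:
  fixes B :: "complex^'n^'n"
  assumes uv: "indep2 u v"
    and B: "B ** adj B - adj B ** B = outer u - outer v"
    and cd: "B *v u - adj B *v v = c *s u + d *s v"
  obtains \<alpha> y s t where "y \<noteq> 0" "\<alpha> *s y - adj B *v y = s *s u" "cnj \<alpha> *s y - B *v y = t *s v"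
proof -
  define r m k where "r = (norm u)\<^sup>2" and "m = hip u v" and "k = c + cnj d"
  have u0: "u \<noteq> 0" "v \<noteq> 0" and vu: "v \<noteq> a *s u" for a
  proof -
    show "u \<noteq> 0" "v \<noteq> 0" by (rule indep2_nonzero[OF uv])+
    show "v \<noteq> a *s u"
    proof
      assume "v = a *s u"
      then have "(- a) *s u + 1 *s v = 0" by simp
      then show False using uv unfolding indep2_def by (metis zero_neq_one)
    qed
  qed
  have n: "norm u = norm v" by (rule commutator_outer_norm[OF B])
  have r: "hip u u = of_real r" "hip v v = of_real r"
    using n by (simp_all add: r_def hip_self)
  have "hip u (B *v u) - cnj (hip v (B *v u)) = c * of_real r + d * m"
    using arg_cong[OF cd, of "hip u"]
    by (simp add: hip_linear r m_def cnj_hip hip_adj)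
  moreover have "hip v (B *v u) - cnj (hip v (B *v v)) = c * cnj m + d * of_real r"
    using arg_cong[OF cd, of "hip v"]
    by (simp add: hip_linear r m_def cnj_hip hip_adj)
  from arg_cong[OF this, of cnj]
  have "cnj (hip v (B *v u)) - hip v (B *v v) = cnj c * m + cnj d * of_real r"
    by simp
  \<comment> \<open>Adding the two relations cancels the terms with \<open>hip v (B *v u)\<close>,
    and \<open>commutator_outer_form\<close> cancels the rest. As \<open>m\<close> is strictly
    smaller than \<open>r\<close> in modulus, \<open>k\<close> must vanish.\<close>
  ultimately have "k * of_real r = - (cnj k * m)"
    using commutator_outer_form[OF B] by (simp add: k_def algebra_simps add_eq_0_iff2)
  then have "cmod (k * of_real r) = cmod (cnj k * m)" by simp
  moreover have "0 \<le> r" by (simp add: r_def)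
  ultimately have "cmod k * r = cmod k * cmod m" by (simp add: norm_mult)
  moreover have "cmod m < r"
    unfolding m_def r_def by (rule hip_CS_strict[OF n vu u0(1)])
  ultimately have "k = 0"
    by auto
  then have d: "d = - cnj c" by (simp add: k_def add_eq_0_iff2 complex_eq_iff)
  \<comment> \<open>\<open>None\<close> indexes the added row and column. The equations
    \<open>e1\<close> to \<open>e3\<close> are the blocks of the normality of
    \<open>N\<close>.\<close>
  define N :: "complex^'n option^'n option"
    where "N = (\<chi> i j. case i of
        None \<Rightarrow> (case j of None \<Rightarrow> c | Some l \<Rightarrow> cnj (u $ l))
      | Some k \<Rightarrow> (case j of None \<Rightarrow> v $ k | Some l \<Rightarrow> B $ k $ l))"
  have N: "N $ None $ None = c" "N $ None $ Some l = cnj (u $ l)"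
    "N $ Some k $ None = v $ k" "N $ Some k $ Some l = B $ k $ l" for k l
    by (simp_all add: N_def)
  have e1: "(\<Sum>j\<in>UNIV. B $ k $ j * cnj (B $ l $ j)) + v $ k * cnj (v $ l)
      = (\<Sum>j\<in>UNIV. cnj (B $ j $ k) * B $ j $ l) + u $ k * cnj (u $ l)" for k l
  proof -
    have "(B ** adj B - adj B ** B) $ k $ l = (outer u - outer v) $ k $ l" by (simp add: B)
    then show ?thesis
      by (simp add: matrix_matrix_mult_def adj_def outer_def algebra_simps)
  qed
  have e2: "(\<Sum>j\<in>UNIV. B $ k $ j * u $ j) + v $ k * cnj c
      = (\<Sum>j\<in>UNIV. cnj (B $ j $ k) * v $ j) + u $ k * c" for k
  proof -
    have "(B *v u - adj B *v v) $ k = (c *s u + d *s v) $ k" by (simp add: cd)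
    then show ?thesis
      by (simp add: matrix_vector_mult_def adj_def d algebra_simps)
  qed
  have e2': "(\<Sum>j\<in>UNIV. cnj (B $ k $ j) * cnj (u $ j)) + cnj (v $ k) * c
      = (\<Sum>j\<in>UNIV. B $ j $ k * cnj (v $ j)) + cnj (u $ k) * cnj c" for k
    using arg_cong[OF e2[of k], of cnj] by simp
  have e3: "(\<Sum>j\<in>UNIV. cnj (u $ j) * u $ j) = (\<Sum>j\<in>UNIV. cnj (v $ j) * v $ j)"
    using r unfolding hip_def by simp
  have "(N ** adj N) $ i $ j = (adj N ** N) $ i $ j" for i j
  proof (cases i; cases j)
    fix k l assume ij: "i = Some k" "j = Some l"
    show ?thesis
      using e1[of k l] unfolding ij
      by (simp add: matrix_matrix_mult_def adj_def sum_option N algebra_simps)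
  next
    fix k assume ij: "i = Some k" "j = None"
    show ?thesis
      using e2[of k] unfolding ij
      by (simp add: matrix_matrix_mult_def adj_def sum_option N algebra_simps)
  next
    fix l assume ij: "i = None" "j = Some l"
    show ?thesis
      using e2'[of l] unfolding ij
      by (simp add: matrix_matrix_mult_def adj_def sum_option N algebra_simps)
  next
    assume ij: "i = None" "j = None"
    show ?thesis
      using e3 unfolding ij
      by (simp add: matrix_matrix_mult_def adj_def sum_option N algebra_simps)
  qed
  then have "N ** adj N = adj N ** N" by (simp add: vec_eq_iff)
  then obtain l z where z: "z \<noteq> 0" "N *v z = l *s z" "adj N *v z = cnj l *s z"
    by (rule normal_eigenvector)
  define y where "y = (\<chi> k. z $ Some k)"
  have z1: "(N *v z) $ Some k = l * z $ Some k" "(adj N *v z) $ Some k = cnj l * z $ Some k" for k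
    by (simp_all add: z)
  \<comment> \<open>The \<open>Some\<close> rows of the eigenvector equations for \<open>N\<close>
    and \<open>adj N\<close>; the border coordinate supplies both coefficients.\<close>
  have 1: "l *s y - B *v y = z $ None *s v"
    using z1(1)
    by (simp add: vec_eq_iff matrix_vector_mult_def sum_option N y_def algebra_simps)
  have 2: "cnj l *s y - adj B *v y = z $ None *s u"
    using z1(2)
    by (simp add: vec_eq_iff matrix_vector_mult_def adj_def sum_option N y_def algebra_simps)
  have "y \<noteq> 0"
  proof
    assume y: "y = 0"
    with 1 u0 have "z $ None = 0" by simp
    moreover have "z $ Some k = 0" for k using y by (simp add: y_def vec_eq_iff)
    ultimately have "z $ i = 0" for i by (cases i) auto
    with z(1) show False by (simp add: vec_eq_iff)
  qed
  with 1 2 show thesis using that[of y "cnj l" "z $ None" "z $ None"] by simp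
qed

lemma rank_one_dilation_eigenvector:
  fixes B :: "complex^'n^'n"
  assumes n: "CARD('n) \<le> 3" and uv: "indep2 u v"
    and B: "B ** adj B - adj B ** B = outer u - outer v"
  obtains \<alpha> y s t where "y \<noteq> 0" "\<alpha> *s y - adj B *v y = s *s u" "cnj \<alpha> *s y - B *v y = t *s v"
proof -
  obtain w c d where w: "cmod w = 1" "w *s (B *v u) - adj B *v v = c *s u + d *s v"
    by (rule phase_exists[OF n uv B])
  have ww: "w * cnj w = 1" using w(1) by (simp add: complex_norm_square[symmetric])
  then have w0: "w \<noteq> 0" by auto
  have "outer (w *s u) = outer u"
    using ww by (simp add: outer_def vec_eq_iff algebra_simps)
  with B have B': "B ** adj B - adj B ** B = outer (w *s u) - outer v" by simp
  have uv': "indep2 (w *s u) v"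
    unfolding indep2_def
  proof (intro allI impI)
    fix a b assume "a *s (w *s u) + b *s v = 0"
    then have "(a * w) *s u + b *s v = 0" by simp
    then show "a = 0 \<and> b = 0" using uv w0 unfolding indep2_def by fastforce
  qed
  have cd: "B *v (w *s u) - adj B *v v = (c * cnj w) *s (w *s u) + d *s v"
    using w(2) ww by (simp add: mult_vec_scale mult.assoc mult.commute)
  obtain \<alpha> y s t
    where "y \<noteq> 0" "\<alpha> *s y - adj B *v y = s *s (w *s u)" "cnj \<alpha> *s y - B *v y = t *s v"
    by (rule normal_dilation_eigenvector[OF uv' B' cd])
  then show thesis using that[of y \<alpha> "s * w" t] by simp
qed

text \<open>In the basis \<open>u, v, v'\<close> the claim is that three coordinates vanish: that of
  \<open>u\<close> in \<open>cnj \<alpha> *s y - B *v y\<close>, those of \<open>v\<close> and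
  \<open>v'\<close> in \<open>\<alpha> *s y - B' *v y\<close>. This is the twisted eigenvalue
  problem for a matrix with one row taken from \<open>B\<close> and two from
  \<open>B'\<close>.\<close>

lemma split_eigenvector:
  fixes B B' :: "complex^'n^'n"
  assumes n: "CARD('n) = 3" and v: "indep2 v v'" and u: "\<And>a b. u \<noteq> a *s v + b *s v'"
  obtains \<alpha> y s t t'
  where "y \<noteq> 0" "\<alpha> *s y - B' *v y = s *s u" "cnj \<alpha> *s y - B *v y = t *s v + t' *s v'"
proof -
  obtain i j k where U: "(UNIV :: 'n set) = {i, j, k}" and ne: "i \<noteq> j" "i \<noteq> k" "j \<noteq> k"
    using n by (metis card_3_iff)
  have sum3: "(\<Sum>l\<in>UNIV. f l) = f i + f j + f k" for f :: "'n \<Rightarrow> complex"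
    unfolding U using ne by simp
  define P :: "complex^'n^'n"
    where "P = (\<chi> r l. if l = i then u $ r else if l = j then v $ r else v' $ r)"
  have P: "P *v x = x $ i *s u + x $ j *s v + x $ k *s v'" for x
    using ne by (simp add: P_def matrix_vector_mult_def vec_eq_iff sum3 mult.commute)
  have "\<exists>z. P *v z = x" for x
  proof -
    obtain a b c where x: "x = a *s v + b *s v' + c *s u"
      using indep3_spans[OF v u, of x] n by auto
    have "P *v (\<chi> l. if l = i then c else if l = j then a else b) = x"
      using ne by (simp add: P x algebra_simps)
    then show ?thesis by blast
  qed
  then have "surj ((*v) P)" unfolding surj_def by metis
  then obtain P' where PP': "P ** P' = mat 1"
    unfolding matrix_right_invertible_surjective[symmetric] by blast
  then have P'P: "P' ** P = mat 1" by (simp add: matrix_left_right_inverse)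
  define M where "M = (\<chi> l. if l = i then (P' ** B ** P) $ l else (P' ** B' ** P) $ l)"
  obtain \<alpha> z where z: "z \<noteq> 0" "\<And>l. (M *v z) $ l = (if l = i then cnj \<alpha> else \<alpha>) * z $ l"
    using twisted_eigenvector[OF n, of M i] by blast
  define y where "y = P *v z"
  have P'y: "P' *v y = z" by (simp add: y_def matrix_vector_mul_assoc P'P)
  have "y \<noteq> 0" using z(1) P'y by auto
  have P'B: "(P' *v (A *v y)) $ l = (P' ** A ** P *v z) $ l" for A l
    by (simp add: y_def matrix_vector_mul_assoc matrix_mul_assoc)
  have Ml: "(M *v z) $ l = (if l = i then (P' ** B ** P *v z) $ l else (P' ** B' ** P *v z) $ l)" for l
    by (simp add: M_def matrix_vector_mult_def)
  have recover: "x = (P' *v x) $ i *s u + (P' *v x) $ j *s v + (P' *v x) $ k *s v'" for x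
    using P[of "P' *v x"] by (simp add: matrix_vector_mul_assoc PP')
  have "(P' *v (\<alpha> *s y - B' *v y)) $ l = 0" if "l \<noteq> i" for l
    using z(2)[of l] Ml[of l] that by (simp add: mult_vec_linear P'B P'y)
  then have "\<alpha> *s y - B' *v y = (P' *v (\<alpha> *s y - B' *v y)) $ i *s u"
    using recover[of "\<alpha> *s y - B' *v y"] ne by simp
  moreover have "(P' *v (cnj \<alpha> *s y - B *v y)) $ i = 0"
    using z(2)[of i] Ml[of i] by (simp add: mult_vec_linear P'B P'y)
  then have "cnj \<alpha> *s y - B *v y
      = (P' *v (cnj \<alpha> *s y - B *v y)) $ j *s v + (P' *v (cnj \<alpha> *s y - B *v y)) $ k *s v'"
    using recover[of "cnj \<alpha> *s y - B *v y"] by simp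
  ultimately show thesis using \<open>y \<noteq> 0\<close> that by blast
qed

section \<open>Common product vectors\<close>

lemma range_mult_vec_combine:
  fixes F :: "complex^'n^'m"
  assumes "x \<in> range ((*v) F)" "y \<in> range ((*v) F)"
  shows "a *s x + b *s y \<in> range ((*v) F)"
proof -
  obtain p q where "x = F *v p" "y = F *v q" using assms by blast
  then have "a *s x + b *s y = F *v (a *s p + b *s q)" by (simp add: mult_vec_linear)
  then show ?thesis by blast
qed

lemma range_outer:
  assumes "u \<noteq> 0"
  shows "a *s u \<in> range ((*v) (outer u))"
proof -
  have "a *s u = outer u *v ((a / hip u u) *s u)"
    using assms by (simp add: outer_mult_vec hip_linear)
  then show ?thesis by blast
qed

text \<open>Rank at most one, with \<open>outer 0\<close> for rank zero, or at least two. If all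
  \<open>F *v x\<close> are multiples of \<open>F *v z\<close>, self-adjointness determines the
  multiple, and \<open>F *v z\<close> divided by \<open>sqrt c\<close> is the required
  \<open>u\<close>.\<close>

lemma psd_rank_one_or_indep:
  assumes "psd F"
  shows "(\<exists>u. F = outer u) \<or> (\<exists>u v. u \<in> range ((*v) F) \<and> v \<in> range ((*v) F) \<and> indep2 u v)"
proof (cases "F = 0")
  case True
  then have "F = outer 0" by (simp add: outer_def vec_eq_iff)
  then show ?thesis by blast
next
  case False
  then obtain z where z: "F *v z \<noteq> 0" using matrix_eqI[of F 0] by auto
  define c where "c = Re (hip z (F *v z))"
  have "c \<noteq> 0" using psd_kernel[OF assms, of z] z by (auto simp: c_def)
  then have c0: "c > 0" using psd_nonneg[OF assms, of z] by (simp add: c_def)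
  have c: "hip z (F *v z) = of_real c" using psd_real[OF assms, of z] by (simp add: c_def complex_eq_iff)
  show ?thesis
  proof (cases "\<forall>x. \<exists>k. F *v x = k *s (F *v z)")
    case True
    define u where "u = of_real (1 / sqrt c) *s (F *v z)"
    have "F *v x = outer u *v x" for x
    proof -
      obtain k where k: "F *v x = k *s (F *v z)" using True by blast
      have "hip (F *v z) x = hip z (F *v x)" by (simp add: hip_adj psd_adj[OF assms])
      also have "\<dots> = k * of_real c" by (simp add: k hip_linear c)
      finally have "outer u *v x = (of_real (1 / sqrt c) * of_real (1 / sqrt c) * of_real c * k) *s (F *v z)"
        by (simp add: u_def outer_mult_vec hip_linear mult_ac)
      also have "of_real (1 / sqrt c) * of_real (1 / sqrt c) * complex_of_real c = 1"
        using c0 by (simp flip: of_real_mult)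
      finally show ?thesis by (simp add: k)
    qed
    then show ?thesis using matrix_eqI by blast
  next
    case False
    then obtain x where x: "\<And>k. F *v x \<noteq> k *s (F *v z)" by blast
    have "indep2 (F *v x) (F *v z)"
      unfolding indep2_def
    proof (intro allI impI)
      fix a b assume ab: "a *s (F *v x) + b *s (F *v z) = 0"
      have "a = 0"
      proof (rule ccontr)
        assume "a \<noteq> 0"
        have "(1 / a) *s (a *s (F *v x) + b *s (F *v z)) = 0" by (simp add: ab)
        with \<open>a \<noteq> 0\<close> have "F *v x + (b / a) *s (F *v z) = 0"
          by (simp add: vec.scale_right_distrib)
        then have "F *v x = (- (b / a)) *s (F *v z)"
          by (simp add: add_eq_0_iff2)
        with x show False by blast
      qed
      with ab z show "a = 0 \<and> b = 0" by simp
    qed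
    then show ?thesis by blast
  qed
qed

lemma psd_trace_0:
  assumes "psd G" "trace G = 0"
  shows "G = 0"
proof -
  have d: "0 \<le> Re (G $ k $ k)" for k
    using psd_nonneg[OF assms(1), of "axis k 1"] by (simp add: hip_axis)
  have "(\<Sum>k\<in>UNIV. Re (G $ k $ k)) = 0"
    using arg_cong[OF assms(2), of Re] by (simp add: trace_def)
  then have "Re (G $ k $ k) = 0" for k
    using d by (simp add: sum_nonneg_eq_0_iff)
  then show ?thesis
    using psd_entry_le[OF assms(1)] by (simp add: vec_eq_iff)
qed

lemma outer_zero [simp]: "outer 0 = 0"
  by (simp add: outer_def vec_eq_iff)

lemma not_indep2I:
  assumes "\<not> indep2 u v" "u \<noteq> 0" "v \<noteq> 0"
  obtains k where "u = k *s v"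
proof -
  obtain a b where ab: "a *s u + b *s v = 0" "a \<noteq> 0 \<or> b \<noteq> 0"
    using assms(1) unfolding indep2_def by blast
  have "a \<noteq> 0" using ab assms(3) by auto
  have "(1 / a) *s (a *s u + b *s v) = 0" by (simp add: ab)
  with \<open>a \<noteq> 0\<close> have "u + (b / a) *s v = 0"
    by (simp add: vec.scale_right_distrib)
  then have "u = (- (b / a)) *s v" by (simp add: add_eq_0_iff2)
  then show thesis by (rule that)
qed

text \<open>The trace excludes \<open>u = 0\<close>, and the disjoint ranges keep \<open>u\<close>
  out of the span of \<open>v\<close> and \<open>v'\<close>. Hence the dimension is 3 and
  \<open>split_eigenvector\<close> applies with \<open>adj B\<close> for \<open>B'\<close>.\<close>

lemma rank_one_case:
  fixes B :: "complex^'n^'n"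
  assumes n: "CARD('n) \<le> 3" and B: "outer u - G = B ** adj B - adj B ** B"
    and G: "psd G" "v \<in> range ((*v) G)" "v' \<in> range ((*v) G)" "indep2 v v'"
    and disj: "\<And>y. y \<in> range ((*v) (outer u)) \<Longrightarrow> y \<in> range ((*v) G) \<Longrightarrow> y = 0"
  obtains \<alpha> y where "y \<noteq> 0" "\<alpha> *s y - adj B *v y \<in> range ((*v) (outer u))"
    "cnj \<alpha> *s y - B *v y \<in> range ((*v) G)"
proof -
  have "v \<noteq> 0" by (rule indep2_nonzero[OF G(4)])
  have u: "u \<noteq> 0"
  proof
    assume "u = 0"
    have "trace (outer u - G) = 0"
      by (simp add: B trace_sub trace_mul_sym[of B "adj B"])
    then have "trace G = 0" using \<open>u = 0\<close> by (simp add: trace_def sum_negf)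
    then have "G = 0" by (rule psd_trace_0[OF G(1)])
    with G(2) \<open>v \<noteq> 0\<close> show False by auto
  qed
  have nspan: "u \<noteq> a *s v + b *s v'" for a b
  proof
    assume "u = a *s v + b *s v'"
    then have "u \<in> range ((*v) G)" using range_mult_vec_combine[OF G(2,3)] by simp
    moreover have "u \<in> range ((*v) (outer u))" using range_outer[OF u, of 1] by simp
    ultimately show False using disj u by blast
  qed
  have "CARD('n) = 3"
  proof (rule ccontr)
    assume "CARD('n) \<noteq> 3"
    with n have "CARD('n) \<le> 2" by simp
    then obtain a b where "u = a *s v + b *s v'" using indep2_spans[OF G(4), of u] by blast
    with nspan show False by blast
  qed
  then obtain \<alpha> y s t t' where y: "y \<noteq> 0" "\<alpha> *s y - adj B *v y = s *s u"
    "cnj \<alpha> *s y - B *v y = t *s v + t' *s v'"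
    by (rule split_eigenvector[OF _ G(4) nspan])
  show thesis
    using that[OF y(1), of \<alpha>] unfolding y(2,3)
    using range_outer[OF u] range_mult_vec_combine[OF G(2,3)] by blast
qed

text \<open>For \<open>F\<close> and \<open>G\<close> the two Schur complements, the conclusion says
  that \<open>(1, \<alpha>) \<otimes> y\<close> is in the range of the block matrix and
  \<open>(1, cnj \<alpha>) \<otimes> y\<close> in that of its block transpose.\<close>

lemma common_product_vector:
  fixes B F G :: "complex^'n^'n"
  assumes n: "CARD('n) \<le> 3" and FG: "psd F" "psd G" "F - G = B ** adj B - adj B ** B"
    and disj: "\<And>y. y \<in> range ((*v) F) \<Longrightarrow> y \<in> range ((*v) G) \<Longrightarrow> y = 0"
  obtains \<alpha> y where "y \<noteq> 0" "\<alpha> *s y - adj B *v y \<in> range ((*v) F)"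
    "cnj \<alpha> *s y - B *v y \<in> range ((*v) G)"
proof -
  consider (one_one) u v where "F = outer u" "G = outer v"
    | (one_two) u v v' where "F = outer u" "v \<in> range ((*v) G)" "v' \<in> range ((*v) G)" "indep2 v v'"
    | (two_one) u v u' where "G = outer v" "u \<in> range ((*v) F)" "u' \<in> range ((*v) F)" "indep2 u u'"
    | (two_two) u u' v v' where "u \<in> range ((*v) F)" "u' \<in> range ((*v) F)" "indep2 u u'"
        "v \<in> range ((*v) G)" "v' \<in> range ((*v) G)" "indep2 v v'"
    using psd_rank_one_or_indep[OF FG(1)] psd_rank_one_or_indep[OF FG(2)] by blast
  then show thesis
  proof cases
    case one_one
    then have B: "B ** adj B - adj B ** B = outer u - outer v" using FG(3) by simp
    show thesis
    proof (cases "u = 0 \<or> v = 0")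
      case True
      with commutator_outer_norm[OF B] have "u = 0" "v = 0" by auto
      with B have "B ** adj B = adj B ** B" by simp
      then obtain c z where "z \<noteq> 0" "B *v z = c *s z" "adj B *v z = cnj c *s z"
        by (rule normal_eigenvector)
      \<comment> \<open>Both differences are 0, which lies in every range.\<close>
      then show thesis using that[of z "cnj c"] by (simp add: range_eqI[of 0 _ 0])
    next
      case False
      have "indep2 u v"
      proof (rule ccontr)
        assume "\<not> indep2 u v"
        then obtain k where "u = k *s v" using not_indep2I False by blast
        then have "u \<in> range ((*v) G)" using range_outer[of v k] one_one False by simp
        moreover have "u \<in> range ((*v) F)" using range_outer[of u 1] one_one False by simp
        ultimately show False using disj False by blast
      qed
      then obtain \<alpha> y s t where y: "y \<noteq> 0" "\<alpha> *s y - adj B *v y = s *s u"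
        "cnj \<alpha> *s y - B *v y = t *s v"
        by (rule rank_one_dilation_eigenvector[OF n _ B])
      have "\<alpha> *s y - adj B *v y \<in> range ((*v) F)"
        unfolding y(2) one_one(1) by (rule range_outer) (use False in simp)
      moreover have "cnj \<alpha> *s y - B *v y \<in> range ((*v) G)"
        unfolding y(3) one_one(2) by (rule range_outer) (use False in simp)
      ultimately show thesis using that[OF y(1), of \<alpha>] by blast
    qed
  next
    case one_two
    show thesis
      by (rule rank_one_case[OF n _ FG(2) one_two(2-4), of u B])
        (use FG(3) one_two(1) disj that in auto)
  next
    case two_one
    \<comment> \<open>Exchanging \<open>B\<close> with \<open>adj B\<close> exchanges
      \<open>F\<close> with \<open>G\<close> and \<alpha> with its conjugate.\<close>
    have "outer v - F = - (F - G)" by (simp add: two_one)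
    also have "\<dots> = adj B ** adj (adj B) - adj (adj B) ** adj B" by (simp add: FG(3))
    finally have "outer v - F = adj B ** adj (adj B) - adj (adj B) ** adj B" .
    then obtain \<alpha> y where "y \<noteq> 0" "\<alpha> *s y - adj (adj B) *v y \<in> range ((*v) (outer v))"
      "cnj \<alpha> *s y - adj B *v y \<in> range ((*v) F)"
      by (rule rank_one_case[OF n _ FG(1) two_one(2-4)]) (use disj two_one(1) in auto)
    then show thesis using that[of y "cnj \<alpha>"] two_one(1) by simp
  next
    case two_two
    \<comment> \<open>Two planes in dimension at most three share a nonzero vector, here
      \<open>x\<close>, against the disjointness of the ranges.\<close>
    have "u \<noteq> 0" by (rule indep2_nonzero[OF two_two(3)])
    have "u \<noteq> a *s v + b *s v'" for a b
    proof
      assume "u = a *s v + b *s v'"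
      then have "u \<in> range ((*v) G)" using range_mult_vec_combine[OF two_two(4,5)] by simp
      with disj[OF two_two(1)] \<open>u \<noteq> 0\<close> show False by blast
    qed
    then obtain a b c where abc: "u' = a *s v + b *s v' + c *s u"
      using indep3_spans[OF two_two(6) _ n, of u u'] by blast
    define x where "x = (- c) *s u + 1 *s u'"
    have "x = a *s v + b *s v'" by (simp add: x_def abc)
    then have "x = 0"
      using disj[of x] range_mult_vec_combine[OF two_two(4,5)]
        range_mult_vec_combine[OF two_two(1,2), of "- c" 1] by (simp add: x_def)
    then have "(- c) *s u + 1 *s u' = 0" by (simp only: x_def)
    then show thesis using two_two(3) unfolding indep2_def by (metis zero_neq_one)
  qed
qed

section \<open>Two by two block matrices\<close>

text \<open>The form of the block matrix with rows \<open>A, B\<close> and \<open>adj B, C\<close>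
  at the stacked vector \<open>(y, z)\<close>.\<close>

definition form :: "complex^'n^'n \<Rightarrow> complex^'n^'n \<Rightarrow> complex^'n^'n \<Rightarrow> complex^'n \<Rightarrow> complex^'n \<Rightarrow> complex"
  where "form A B C y z = hip y (A *v y) + hip y (B *v z) + hip z (adj B *v y) + hip z (C *v z)"

text \<open>
  A product vector \<open>(a, b) \<otimes> y\<close> in the range of the block matrix with rows \<open>A, B\<close> and
  \<open>B\<^sup>*, C\<close> whose conjugate \<open>(cnj a, cnj b) \<otimes> y\<close> is in the range of the block transpose.
\<close>

definition product_in_range :: "complex^'n^'n \<Rightarrow> complex^'n^'n \<Rightarrow> complex^'n^'n \<Rightarrow> bool"
  where "product_in_range A B C \<longleftrightarrow> (\<exists>a b y \<xi> \<eta> \<xi>' \<eta>'. y \<noteq> 0 \<and> (a \<noteq> 0 \<or> b \<noteq> 0) \<and>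
    A *v \<xi> + B *v \<eta> = a *s y \<and> adj B *v \<xi> + C *v \<eta> = b *s y \<and>
    A *v \<xi>' + adj B *v \<eta>' = cnj a *s y \<and> B *v \<xi>' + C *v \<eta>' = cnj b *s y)"

text \<open>The choice \<open>y = - (B *v z)\<close> minimizes the form in \<open>y\<close>.\<close>

lemma schur_complement_psd:
  assumes "\<And>y z. form (mat 1) B C y z \<in> \<real>\<^sub>\<ge>\<^sub>0"
  shows "psd (C - adj B ** B)"
  unfolding psd_hip
proof
  fix z
  have "hip z ((C - adj B ** B) *v z) = form (mat 1) B C (- (B *v z)) z"
    by (simp add: form_def matrix_vector_mult_diff_rdistrib hip_linear hip_adj'
        vec.neg flip: matrix_vector_mul_assoc)
  then show "hip z ((C - adj B ** B) *v z) \<in> \<real>\<^sub>\<ge>\<^sub>0" using assms by simp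
qed

lemma product_in_range_normalized:
  fixes B C :: "complex^'n^'n"
  assumes n: "CARD('n) \<le> 3"
    and P: "\<And>y z. form (mat 1) B C y z \<in> \<real>\<^sub>\<ge>\<^sub>0" "\<And>y z. form (mat 1) (adj B) C y z \<in> \<real>\<^sub>\<ge>\<^sub>0"
  shows "product_in_range (mat 1) B C"
proof -
  define F G where "F = C - adj B ** B" and "G = C - B ** adj B"
  have psd: "psd F" "psd G"
    using schur_complement_psd[OF P(1)] schur_complement_psd[OF P(2)] by (simp_all add: F_def G_def)
  have FG: "F - G = B ** adj B - adj B ** B" by (simp add: F_def G_def)
  have Fv: "F *v x = C *v x - adj B *v (B *v x)" and Gv: "G *v x = C *v x - B *v (adj B *v x)" for x
    by (simp_all add: F_def G_def matrix_vector_mult_diff_rdistrib matrix_vector_mul_assoc)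
  show ?thesis
  proof (cases "\<exists>y. y \<noteq> 0 \<and> y \<in> range ((*v) F) \<and> y \<in> range ((*v) G)")
    case True
    then obtain y x x' where y: "y \<noteq> 0" "y = F *v x" "y = G *v x'" by blast
    show ?thesis
      \<comment> \<open>Taking \<xi> as \<open>- (B *v x)\<close> kills the first block row and
        turns the second into \<open>F *v x\<close>; likewise for \<open>G\<close>.\<close>
      unfolding product_in_range_def
      by (rule exI[of _ 0], rule exI[of _ 1], rule exI[of _ y], rule exI[of _ "- (B *v x)"],
          rule exI[of _ x], rule exI[of _ "- (adj B *v x')"], rule exI[of _ x'])
        (use y in \<open>simp add: Fv Gv vec.neg\<close>)
  next
    case False
    then have disj: "y = 0" if "y \<in> range ((*v) F)" "y \<in> range ((*v) G)" for y
      using that by blast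
    obtain \<alpha> y where y: "y \<noteq> 0" "\<alpha> *s y - adj B *v y \<in> range ((*v) F)"
        "cnj \<alpha> *s y - B *v y \<in> range ((*v) G)"
      by (rule common_product_vector[OF n psd FG disj])
    then obtain x x' where x: "\<alpha> *s y - adj B *v y = F *v x" "cnj \<alpha> *s y - B *v y = G *v x'"
      by blast
    show ?thesis
      \<comment> \<open>For \<open>(1, \<alpha>) \<otimes> y\<close> the first block row forces
        \<xi> to be \<open>y - B *v x\<close>; the second then reads
        \<open>F *v x = \<alpha> *s y - adj B *v y\<close>.\<close>
      unfolding product_in_range_def
      by (rule exI[of _ 1], rule exI[of _ \<alpha>], rule exI[of _ y], rule exI[of _ "y - B *v x"],
          rule exI[of _ x], rule exI[of _ "y - adj B *v x'"], rule exI[of _ x'])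
        (use y x in \<open>simp add: Fv Gv mult_vec_linear algebra_simps\<close>)
  qed
qed

text \<open>Compressing by \<open>L\<close> turns \<open>A\<close> into the identity in dimension
  the rank of \<open>A\<close>. The kernel assumption puts the ranges of \<open>B\<close>,
  \<open>adj B\<close> and \<open>C\<close> inside that of \<open>G\<close>, so the solution lifts
  back through \<open>G\<close>.\<close>

lemma product_in_range_factor:
  fixes A B C :: "complex^'p^'p" and G :: "complex^'m^'p"
  assumes m: "CARD('m) \<le> 3" and A: "A = G ** adj G" and L: "L ** G = mat 1"
    and P: "\<And>y z. form A B C y z \<in> \<real>\<^sub>\<ge>\<^sub>0" "\<And>y z. form A (adj B) C y z \<in> \<real>\<^sub>\<ge>\<^sub>0"
    and C: "adj C = C"
    and ker: "\<And>x. A *v x = 0 \<Longrightarrow> B *v x = 0 \<and> adj B *v x = 0 \<and> C *v x = 0"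
  shows "product_in_range A B C"
proof -
  define B' C' where "B' = L ** B ** adj L" and "C' = L ** C ** adj L"
  have adjGL: "adj G ** adj L = mat 1" by (simp add: L flip: adj_mult)
  have LG: "L *v (G *v x) = x" and GL: "adj G *v (adj L *v x) = x" for x
    by (simp_all add: matrix_vector_mul_assoc L adjGL)
  have Av: "A *v x = G *v (adj G *v x)" for x
    by (simp add: A matrix_vector_mul_assoc)
  have adjB': "adj B' = L ** adj B ** adj L"
    by (simp add: B'_def adj_mult matrix_mul_assoc)
  have hat: "(L ** X ** adj L) *v x = L *v (X *v (adj L *v x))" for X and x :: "complex^'m"
    by (simp add: matrix_vector_mul_assoc matrix_mul_assoc)
  have lift: "hip y (L *v x) = hip (adj L *v y) x" for x y
    by (rule hip_adj)
  have hats: "form (mat 1) B' C' y z = form A B C (adj L *v y) (adj L *v z)"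
    "form (mat 1) (adj B') C' y z = form A (adj B) C (adj L *v y) (adj L *v z)" for y z
    by (simp_all add: form_def, simp_all add: adjB', simp_all add: B'_def C'_def hat lift Av GL)
       (simp_all add: hip_adj[of _ G] GL)
  have "product_in_range (mat 1) B' C'"
    by (rule product_in_range_normalized[OF m]) (simp_all add: hats P)
  then obtain a b y \<xi> \<eta> \<xi>' \<eta>' where y: "y \<noteq> 0" "a \<noteq> 0 \<or> b \<noteq> 0"
    "\<xi> + B' *v \<eta> = a *s y" "adj B' *v \<xi> + C' *v \<eta> = b *s y"
    "\<xi>' + adj B' *v \<eta>' = cnj a *s y" "B' *v \<xi>' + C' *v \<eta>' = cnj b *s y"
    unfolding product_in_range_def matrix_vector_mul_lid by blast
  \<comment> \<open>\<open>x - adj L *v (adj G *v x)\<close> is in the kernel of \<open>A\<close>,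
    hence in that of \<open>adj X\<close>; thus \<open>G ** L\<close> fixes the range of
    \<open>X\<close>.\<close>
  have proj: "G *v (L *v (X *v t)) = X *v t" if "\<And>x. A *v x = 0 \<Longrightarrow> adj X *v x = 0" for X t
  proof -
    have "hip x (X *v t - G *v (L *v (X *v t))) = 0" for x
    proof -
      have "A *v (x - adj L *v (adj G *v x)) = 0"
        by (simp add: Av mult_vec_linear GL)
      from that[OF this] have "hip (x - adj L *v (adj G *v x)) (X *v t) = 0"
        by (simp add: hip_adj)
      then show ?thesis by (simp add: hip_linear hip_adj mult_vec_linear)
    qed
    then have "X *v t - G *v (L *v (X *v t)) = 0" by (rule hip_eq_0_imp)
    then show ?thesis by simp
  qed
  have GB: "G *v (B' *v t) = B *v (adj L *v t)" "G *v (adj B' *v t) = adj B *v (adj L *v t)"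
    "G *v (C' *v t) = C *v (adj L *v t)" for t
    unfolding adjB' unfolding B'_def C'_def hat using ker C by (auto intro!: proj)
  have AL: "A *v (adj L *v t) = G *v t" for t by (simp add: Av GL)
  have "G *v y \<noteq> 0" using LG[of y] y(1) by auto
  moreover have "A *v (adj L *v \<xi>) + B *v (adj L *v \<eta>) = a *s (G *v y)"
    "adj B *v (adj L *v \<xi>) + C *v (adj L *v \<eta>) = b *s (G *v y)"
    "A *v (adj L *v \<xi>') + adj B *v (adj L *v \<eta>') = cnj a *s (G *v y)"
    "B *v (adj L *v \<xi>') + C *v (adj L *v \<eta>') = cnj b *s (G *v y)"
    by (simp_all add: AL flip: GB mult_vec_linear y(3-6))
  ultimately show ?thesis using y(2) unfolding product_in_range_def by blast
qed

text \<open>One step of a Cholesky factorization, with \<open>g\<close> the vector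
  \<open>A *v z\<close> divided by the square root of \<open>hip z (A *v z)\<close>. Old kernel
  vectors stay and \<open>z\<close> joins them, so iterating gives a triangular array of pairings
  with nonzero diagonal.\<close>

lemma psd_peel:
  assumes "psd A" "A \<noteq> 0"
  obtains z g where "psd (A - outer g)" "(A - outer g) *v z = 0" "hip z g \<noteq> 0"
    "\<And>x. A *v x = 0 \<Longrightarrow> (A - outer g) *v x = 0 \<and> hip x g = 0"
proof -
  from assms(2) obtain z where z: "A *v z \<noteq> 0" using matrix_eqI[of A 0] by auto
  define c where "c = Re (hip z (A *v z))"
  have "c \<noteq> 0" using psd_kernel[OF assms(1), of z] z by (auto simp: c_def)
  then have c0: "c > 0" using psd_nonneg[OF assms(1), of z] by (simp add: c_def)
  have c: "hip z (A *v z) = of_real c"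
    using psd_real[OF assms(1), of z] by (simp add: c_def complex_eq_iff)
  have cc: "of_real (1 / sqrt c) * of_real (1 / sqrt c) = complex_of_real (1 / c)"
    using c0 by (simp flip: of_real_mult)
  define g where "g = of_real (1 / sqrt c) *s (A *v z)"
  have og: "outer g = (1 / c) *\<^sub>R outer (A *v z)"
  proof (rule matrix_eqI)
    fix x
    have "outer g *v x = (of_real (1 / sqrt c) * of_real (1 / sqrt c) * hip (A *v z) x) *s (A *v z)"
      by (simp add: g_def outer_mult_vec hip_linear mult_ac)
    also have "\<dots> = ((1 / c) *\<^sub>R outer (A *v z)) *v x"
      unfolding cc scaleR_matrix_vector outer_mult_vec
      by (simp add: vec_eq_iff scaleR_conv_of_real[where 'a = complex])
    finally show "outer g *v x = ((1 / c) *\<^sub>R outer (A *v z)) *v x" .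
  qed
  have "psd (A - outer g)"
    unfolding og using c0 by (intro psd_diff_outer[OF assms(1) refl]) (simp_all add: c)
  moreover have "outer g *v z = A *v z"
  proof -
    have "hip (A *v z) z = of_real c" using c by (metis cnj_hip complex_cnj_complex_of_real)
    then show ?thesis
      unfolding og scaleR_matrix_vector outer_mult_vec using c0
      by (simp add: vec_eq_iff scaleR_conv_of_real[where 'a = complex])
  qed
  then have "(A - outer g) *v z = 0" by (simp add: matrix_vector_mult_diff_rdistrib)
  moreover have "hip z g \<noteq> 0" using c0 by (simp add: g_def hip_linear c)
  moreover have "(A - outer g) *v x = 0 \<and> hip x g = 0" if "A *v x = 0" for x
  proof -
    have "hip x (A *v z) = 0" using that by (simp add: hip_adj psd_adj[OF assms(1)])
    then have 1: "hip x g = 0" by (simp add: g_def hip_linear)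
    then have "hip g x = 0" by (metis cnj_hip complex_cnj_zero)
    with 1 that show ?thesis by (simp add: matrix_vector_mult_diff_rdistrib outer_mult_vec)
  qed
  ultimately show thesis by (rule that)
qed

text \<open>At \<open>((of_real s * cnj m) *s f, z)\<close> the form is affine in the real number
  \<open>s\<close> and never negative, so its slope vanishes.\<close>

lemma form_kernel:
  assumes P: "\<And>y z. form A B C y z \<in> \<real>\<^sub>\<ge>\<^sub>0" and f: "A *v f = 0"
  shows "adj B *v f = 0"
proof (rule hip_eq_0_imp)
  fix z
  define m d where "m = hip z (adj B *v f)" and "d = Re (hip z (C *v z))"
  have m': "hip f (B *v z) = cnj m" by (simp add: m_def cnj_hip hip_adj)
  have ineq: "0 \<le> d + 2 * s * (cmod m)\<^sup>2" for s
  proof -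
    have "0 \<le> Re (form A B C ((of_real s * cnj m) *s f) z)"
      using P by (simp add: complex_nonneg_Reals_iff)
    also have "\<dots> = d + 2 * s * (cmod m)\<^sup>2"
      unfolding cmod_power2
      by (simp add: form_def mult_vec_scale f hip_linear m' flip: m_def d_def)
        (simp add: power2_eq_square algebra_simps)
    finally show ?thesis .
  qed
  show "hip z (adj B *v f) = 0"
  proof (rule ccontr)
    assume "hip z (adj B *v f) \<noteq> 0"
    then have "cmod m \<noteq> 0" by (simp add: m_def)
    then have k: "2 * (- (d + 1) / (2 * (cmod m)\<^sup>2)) * (cmod m)\<^sup>2 = - (d + 1)"
      by (simp add: field_simps)
    have "0 \<le> d + - (d + 1)"
      using ineq[of "- (d + 1) / (2 * (cmod m)\<^sup>2)"] unfolding k .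
    then show False by simp
  qed
qed

lemma left_inverse_exists:
  fixes G :: "complex^'m^'p"
  assumes "\<And>x. G *v x = 0 \<Longrightarrow> x = 0"
  obtains L where "L ** G = mat 1"
  using assms matrix_left_invertible_ker[of G] by blast

lemma block_product_in_range:
  fixes A B C :: "complex^'p^'p"
  assumes p: "CARD('p) \<le> 3"
    and P: "\<And>y z. form A B C y z \<in> \<real>\<^sub>\<ge>\<^sub>0" "\<And>y z. form A (adj B) C y z \<in> \<real>\<^sub>\<ge>\<^sub>0"
    and nz: "A \<noteq> 0 \<or> B \<noteq> 0 \<or> C \<noteq> 0"
  shows "product_in_range A B C"
proof -
  have psd: "psd A" "psd C"
    using P(1)[of _ 0] P(1)[of 0] by (auto simp: psd_hip form_def)
  have kerB: "B *v f = 0" "adj B *v f = 0" if "A *v f = 0" for f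
    using form_kernel[OF P(1) that] form_kernel[OF P(2) that] by simp_all
  show ?thesis
  proof (cases "\<exists>f. A *v f = 0 \<and> C *v f \<noteq> 0")
    case True
    then obtain f where f: "A *v f = 0" "C *v f \<noteq> 0" by blast
    \<comment> \<open>The product vector is \<open>(0, 1) \<otimes> (C *v f)\<close>, with preimage
      \<open>(0, f)\<close> for the block matrix and its block transpose alike.\<close>
    show ?thesis
      unfolding product_in_range_def
      by (rule exI[of _ 0], rule exI[of _ 1], rule exI[of _ "C *v f"], rule exI[of _ 0],
          rule exI[of _ f], rule exI[of _ 0], rule exI[of _ f])
        (simp add: f kerB)
  next
    case False
    with kerB have ker: "B *v f = 0 \<and> adj B *v f = 0 \<and> C *v f = 0" if "A *v f = 0" for f
      using that by blast
    have "A \<noteq> 0"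
    proof
      assume "A = 0"
      then have "B = 0" "C = 0" using ker by (auto intro!: matrix_eqI)
      with nz \<open>A = 0\<close> show False by simp
    qed
    \<comment> \<open>The rank of \<open>A\<close> must appear as the column type of
      \<open>G\<close>, so the peeling below treats ranks 1, 2 and 3 separately.\<close>
    have factor: "product_in_range A B C"
      if m: "CARD('m) \<le> 3" and AG: "A = G ** adj G" and inj: "\<And>x. G *v x = 0 \<Longrightarrow> x = 0" for G :: "complex^'m^'p"
    proof -
      obtain L where "L ** G = mat 1" by (rule left_inverse_exists[OF inj]) blast
      then show ?thesis
        by (rule product_in_range_factor[OF m AG _ P psd_adj[OF psd(2)] ker])
    qed
    obtain z1 g1 where 1: "psd (A - outer g1)" "(A - outer g1) *v z1 = 0" "hip z1 g1 \<noteq> 0"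
      by (rule psd_peel[OF psd(1) \<open>A \<noteq> 0\<close>]) blast
    show ?thesis
    proof (cases "A - outer g1 = 0")
      case True
      define G :: "complex^1^'p" where "G = (\<chi> r l. g1 $ r)"
      have G: "G *v x = x $ 1 *s g1" for x
        by (simp add: G_def matrix_vector_mult_def vec_eq_iff sum_1 mult.commute)
      show ?thesis
      proof (rule factor)
        show "A = G ** adj G"
          using True by (simp add: G_def matrix_matrix_mult_def adj_def outer_def vec_eq_iff sum_1)
        show "x = 0" if "G *v x = 0" for x
          using that 1(3) by (auto simp: G vec_eq_iff[of x] forall_1)
      qed simp
    next
      case nz1: False
      obtain z2 g2 where 2: "psd (A - outer g1 - outer g2)" "(A - outer g1 - outer g2) *v z2 = 0"
          "hip z2 g2 \<noteq> 0"
          "\<And>x. (A - outer g1) *v x = 0 \<Longrightarrow> (A - outer g1 - outer g2) *v x = 0 \<and> hip x g2 = 0"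
        by (rule psd_peel[OF 1(1) nz1]) blast
      note z1 = 2(4)[OF 1(2)]
      show ?thesis
      proof (cases "A - outer g1 - outer g2 = 0")
        case True
        define G :: "complex^2^'p" where "G = (\<chi> r l. if l = 1 then g1 $ r else g2 $ r)"
        have G: "G *v x = x $ 1 *s g1 + x $ 2 *s g2" for x
          by (simp add: G_def matrix_vector_mult_def vec_eq_iff sum_2 mult.commute)
        show ?thesis
        proof (rule factor)
          have "A = outer g1 + outer g2" using True by (simp add: algebra_simps)
          then show "A = G ** adj G"
            by (simp add: G_def matrix_matrix_mult_def adj_def outer_def vec_eq_iff sum_2)
          show "x = 0" if "G *v x = 0" for x
          proof -
            have "hip z1 (G *v x) = 0" using that by simp
            then have x1: "x $ 1 = 0" using 1(3) z1 by (simp add: G hip_linear)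
            have "hip z2 (G *v x) = 0" using that by simp
            then have "x $ 2 = 0" using 2(3) x1 by (simp add: G hip_linear)
            with x1 show ?thesis by (simp add: vec_eq_iff forall_2)
          qed
        qed simp
      next
        case nz2: False
        obtain z3 g3 where 3: "psd (A - outer g1 - outer g2 - outer g3)"
            "(A - outer g1 - outer g2 - outer g3) *v z3 = 0" "hip z3 g3 \<noteq> 0"
            "\<And>x. (A - outer g1 - outer g2) *v x = 0 \<Longrightarrow>
              (A - outer g1 - outer g2 - outer g3) *v x = 0 \<and> hip x g3 = 0"
          by (rule psd_peel[OF 2(1) nz2]) blast
        note z1' = 3(4)[OF conjunct1[OF z1]] and z2 = 3(4)[OF 2(2)]
        have g12: "indep2 g1 g2"
          unfolding indep2_def
        proof (intro allI impI)
          fix a b assume ab: "a *s g1 + b *s g2 = 0"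
          have "hip z1 (a *s g1 + b *s g2) = 0" using ab by simp
          then have "a = 0" using 1(3) z1 by (simp add: hip_linear)
          moreover have "hip z2 (a *s g1 + b *s g2) = 0" using ab by simp
          ultimately show "a = 0 \<and> b = 0" using 2(3) by (simp add: hip_linear)
        qed
        have g3: "g3 \<noteq> a *s g1 + b *s g2" for a b
        proof
          assume ab: "g3 = a *s g1 + b *s g2"
          have "a = 0" using arg_cong[OF ab, of "hip z1"] 1(3) z1 z1' by (simp add: hip_linear)
          moreover then have "b = 0"
            using arg_cong[OF ab, of "hip z2"] 2(3) z2 by (simp add: hip_linear)
          ultimately show False using ab 3(3) by simp
        qed
        show ?thesis
        proof (cases "A - outer g1 - outer g2 - outer g3 = 0")
          case True
          define G :: "complex^3^'p"
            where "G = (\<chi> r l. if l = 1 then g1 $ r else if l = 2 then g2 $ r else g3 $ r)"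
          have G: "G *v x = x $ 1 *s g1 + x $ 2 *s g2 + x $ 3 *s g3" for x
            by (simp add: G_def matrix_vector_mult_def vec_eq_iff sum_3 mult.commute)
          show ?thesis
          proof (rule factor)
            have "A = outer g1 + outer g2 + outer g3" using True by (simp add: algebra_simps)
            then show "A = G ** adj G"
              by (simp add: G_def matrix_matrix_mult_def adj_def outer_def vec_eq_iff sum_3)
            show "x = 0" if "G *v x = 0" for x
            proof -
              have "hip z1 (G *v x) = 0" using that by simp
              then have x1: "x $ 1 = 0" using 1(3) z1 z1' by (simp add: G hip_linear)
              have "hip z2 (G *v x) = 0" using that by simp
              then have x2: "x $ 2 = 0" using 2(3) z2 x1 by (simp add: G hip_linear)
              have "hip z3 (G *v x) = 0" using that by simp
              then have "x $ 3 = 0" using 3(3) x1 x2 by (simp add: G hip_linear)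
              with x1 x2 show ?thesis by (simp add: vec_eq_iff forall_3)
            qed
          qed simp
        next
          case nz3: False
          \<comment> \<open>A fourth peeled vector is orthogonal to \<open>z1, z2, z3\<close>; by
            triangularity its coefficients in the basis \<open>g1, g2, g3\<close> all
            vanish.\<close>
          obtain z4 g4 where 4: "hip z4 g4 \<noteq> 0"
              "\<And>x. (A - outer g1 - outer g2 - outer g3) *v x = 0 \<Longrightarrow> hip x g4 = 0"
            by (rule psd_peel[OF 3(1) nz3]) blast
          have g4: "hip z1 g4 = 0" "hip z2 g4 = 0" "hip z3 g4 = 0"
            using 4(2) z1' z2 3(2) by blast+
          obtain a b c where g: "g4 = a *s g1 + b *s g2 + c *s g3"
            using indep3_spans[OF g12 g3 p, of g4] by blast
          have "a = 0"
            using arg_cong[OF g, of "hip z1"] g4 1(3) z1 z1' by (simp add: hip_linear)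
          moreover then have "b = 0"
            using arg_cong[OF g, of "hip z2"] g4 2(3) z2 by (simp add: hip_linear)
          moreover from calculation have "c = 0"
            using arg_cong[OF g, of "hip z3"] g4 3(3) by (simp add: hip_linear)
          ultimately have "g4 = 0" using g by simp
          with 4(1) show ?thesis by simp
        qed
      qed
    qed
  qed
qed

text \<open>\<open>h\<close> splits the index set into two blocks and \<open>S'\<close> is the block
  transpose. Leaving \<open>h\<close> free covers the two-dimensional factor in either tensor
  position.\<close>

lemma wrapped_product_in_range:
  fixes S S' :: "complex^'a^'a" and h :: "bool \<Rightarrow> 'n::finite \<Rightarrow> 'a"
  assumes h: "bij (\<lambda>(i, k). h i k)" and n: "CARD('n) \<le> 3"
    and S: "psd S" "psd S'" "S \<noteq> 0"
    and S': "\<And>i j k l. S' $ h i k $ h j l = S $ h j k $ h i l"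
  obtains x v v' and y :: "complex^'n"
  where "y \<noteq> 0" "x False \<noteq> 0 \<or> x True \<noteq> 0" "v \<in> range ((*v) S)" "v' \<in> range ((*v) S')"
    "\<And>i k. v $ h i k = x i * y $ k" "\<And>i k. v' $ h i k = cnj (x i) * y $ k"
proof -
  have sumh: "(\<Sum>a\<in>UNIV. f a) = (\<Sum>k\<in>UNIV. f (h False k)) + (\<Sum>k\<in>UNIV. f (h True k))"
    for f :: "'a \<Rightarrow> complex"
  proof -
    have "(\<Sum>a\<in>UNIV. f a) = (\<Sum>p\<in>UNIV. f (case p of (i, k) \<Rightarrow> h i k))"
      using sum.reindex_bij_betw[OF h, of f] by simp
    also have "\<dots> = (\<Sum>p\<in>UNIV \<times> UNIV. f (case p of (i, k) \<Rightarrow> h i k))" by simp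
    also have "\<dots> = (\<Sum>i\<in>UNIV. \<Sum>k\<in>UNIV. f (h i k))"
      unfolding sum.cartesian_product by (rule sum.cong) auto
    finally show ?thesis by (simp add: UNIV_bool)
  qed
  have surj: "\<exists>i k. a = h i k" for a
    using bij_is_surj[OF h] by (metis (mono_tags, lifting) case_prod_conv surjD surj_pair)
  define w where "w = (\<lambda>y z :: complex^'n. \<chi> a. case inv (\<lambda>(i, k). h i k) a of (i, k) \<Rightarrow> if i then z $ k else y $ k)"
  have w: "w y z $ h False k = y $ k" "w y z $ h True k = z $ k" for y z k
    using inv_f_f[OF bij_is_inj[OF h], of "(False, k)"] inv_f_f[OF bij_is_inj[OF h], of "(True, k)"]
    by (simp_all add: w_def)
  define A B C where "A = (\<chi> k l. S $ h False k $ h False l)"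
    and "B = (\<chi> k l. S $ h False k $ h True l)" and "C = (\<chi> k l. S $ h True k $ h True l)"
  have adjB: "adj B = (\<chi> k l. S $ h True k $ h False l)"
    using psd_cnj[OF S(1)] by (simp add: B_def adj_def vec_eq_iff)
  have Sw: "(S *v w y z) $ h False k = (A *v y + B *v z) $ k"
    "(S *v w y z) $ h True k = (adj B *v y + C *v z) $ k"
    "(S' *v w y z) $ h False k = (A *v y + adj B *v z) $ k"
    "(S' *v w y z) $ h True k = (B *v y + C *v z) $ k" for y z k
    unfolding adjB by (simp_all add: matrix_vector_mult_def sumh w A_def B_def C_def S')
  have hipw: "hip (w y z) v = (\<Sum>k\<in>UNIV. cnj (y $ k) * v $ h False k) + (\<Sum>k\<in>UNIV. cnj (z $ k) * v $ h True k)"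
    for y z v
    by (simp add: hip_def sumh w)
  have "form A B C y z = hip (w y z) (S *v w y z)"
    "form A (adj B) C y z = hip (w y z) (S' *v w y z)" for y z
    unfolding hipw Sw form_def
    by (simp_all add: hip_def sum.distrib distrib_left)
  then have P: "\<And>y z. form A B C y z \<in> \<real>\<^sub>\<ge>\<^sub>0" "\<And>y z. form A (adj B) C y z \<in> \<real>\<^sub>\<ge>\<^sub>0"
    using S by (simp_all add: psd_hip)
  have "A \<noteq> 0 \<or> B \<noteq> 0 \<or> C \<noteq> 0"
  proof (rule ccontr)
    assume "\<not> (A \<noteq> 0 \<or> B \<noteq> 0 \<or> C \<noteq> 0)"
    then have "A = 0" "B = 0" "C = 0" "adj B = 0" by (simp_all add: adj_def vec_eq_iff)
    then have "S $ h i k $ h j l = 0" for i j k l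
      unfolding adjB unfolding A_def B_def C_def by (cases i; cases j) (simp_all add: vec_eq_iff)
    then have "S = 0" using surj by (metis vec_eq_iff zero_index)
    with S(3) show False by simp
  qed
  then obtain a b y \<xi> \<eta> \<xi>' \<eta>' where y: "y \<noteq> 0" "a \<noteq> 0 \<or> b \<noteq> 0"
    "A *v \<xi> + B *v \<eta> = a *s y" "adj B *v \<xi> + C *v \<eta> = b *s y"
    "A *v \<xi>' + adj B *v \<eta>' = cnj a *s y" "B *v \<xi>' + C *v \<eta>' = cnj b *s y"
    using block_product_in_range[OF n P] unfolding product_in_range_def by blast
  define x where "x = (\<lambda>i. if i then b else a)"
  show thesis
  proof (rule that[of y x "S *v w \<xi> \<eta>" "S' *v w \<xi>' \<eta>'"])
    show "(S *v w \<xi> \<eta>) $ h i k = x i * y $ k" "(S' *v w \<xi>' \<eta>') $ h i k = cnj (x i) * y $ k" for i k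
      unfolding atomize_conj by (cases i) (simp_all only: Sw y x_def if_True if_False vector_smult_component)
  qed (use y in \<open>simp_all add: x_def\<close>)
qed

section \<open>Transposition, and the vanishing of edge matrices\<close>

lemma psd_transpose:
  assumes "psd A"
  shows "psd (transpose A)"
proof -
  have "hip v (transpose A *v v) = hip (vcnj v) (A *v vcnj v)" for v
  proof -
    have "hip v (transpose A *v v) = (\<Sum>i\<in>UNIV. \<Sum>j\<in>UNIV. cnj (v $ i) * (A $ j $ i * v $ j))"
      by (simp add: hip_def matrix_vector_mult_def transpose_def sum_distrib_left)
    also have "\<dots> = (\<Sum>j\<in>UNIV. \<Sum>i\<in>UNIV. cnj (v $ i) * (A $ j $ i * v $ j))" by (rule sum.swap)
    also have "\<dots> = hip (vcnj v) (A *v vcnj v)"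
      by (simp add: hip_def matrix_vector_mult_def vcnj_def sum_distrib_left mult_ac)
    finally show ?thesis .
  qed
  with assms show ?thesis by (simp add: psd_hip)
qed

lemma vcnj_mult: "psd A \<Longrightarrow> vcnj (transpose A *v x) = A *v vcnj x"
  by (simp add: vcnj_def matrix_vector_mult_def transpose_def vec_eq_iff psd_cnj)

lemma card_2_bij:
  assumes "CARD('a::finite) = 2"
  obtains f :: "bool \<Rightarrow> 'a::finite" where "bij f"
  using finite_same_card_bij[of "UNIV :: bool set" "UNIV :: 'a set"] assms
  by (auto simp: bij_betw_def bij_def)

lemma edge_eq_0:
  fixes S :: "complex^('q::finite \<times> 'p::finite)^('q \<times> 'p)"
  assumes "edge S" and n: "CARD('q) = 2 \<and> CARD('p) \<le> 3 \<or> CARD('p) = 2 \<and> CARD('q) \<le> 3"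
  shows "S = 0"
proof (rule ccontr)
  assume "S \<noteq> 0"
  from assms(1) have psd: "psd S" "psd (ptranspose S)"
    and edge: "\<And>x y. tensor_vec x y \<in> range ((*v) S) \<Longrightarrow> tensor_vec x (vcnj y) \<in> range ((*v) (ptranspose S)) \<Longrightarrow> x = 0 \<or> y = 0"
    by (auto simp: edge_def)
  from n show False
  proof
    assume c: "CARD('q) = 2 \<and> CARD('p) \<le> 3"
    obtain f :: "bool \<Rightarrow> 'q" where f: "bij f" using card_2_bij c by blast
    have h: "bij (\<lambda>(i, k). (f i, k :: 'p))"
      using bij_betw_map_prod[of f UNIV UNIV id UNIV UNIV] f by (simp add: map_prod_def)
    \<comment> \<open>The block transpose acts on the first factor here, so it is the full transpose
      of \<open>ptranspose S\<close>; \<open>vcnj\<close> carries its range to that of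
      \<open>ptranspose S\<close>.\<close>
    obtain x v v' and y :: "complex^'p" where y: "y \<noteq> 0" "x False \<noteq> 0 \<or> x True \<noteq> 0"
      "v \<in> range ((*v) S)" "v' \<in> range ((*v) (transpose (ptranspose S)))"
      "\<And>i k. v $ (f i, k) = x i * y $ k" "\<And>i k. v' $ (f i, k) = cnj (x i) * y $ k"
      by (rule wrapped_product_in_range[OF h conjunct2[OF c] psd(1) psd_transpose[OF psd(2)] \<open>S \<noteq> 0\<close>])
        (auto simp: transpose_def ptranspose_def)
    define X where "X = (\<chi> i. x (inv f i))"
    have X: "X $ f i = x i" for i using f by (simp add: X_def bij_is_inj)
    have fs: "\<exists>j. i = f j" for i using f by (metis bij_pointE)
    have "v = tensor_vec X y"
    proof (unfold vec_eq_iff, clarify)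
      fix i k
      obtain j where "i = f j" using fs by blast
      then show "v $ (i, k) = tensor_vec X y $ (i, k)" using y(5)[of j k] by (simp add: tensor_vec_def X)
    qed
    moreover have "vcnj v' = tensor_vec X (vcnj y)"
    proof (unfold vec_eq_iff, clarify)
      fix i k
      obtain j where "i = f j" using fs by blast
      then show "vcnj v' $ (i, k) = tensor_vec X (vcnj y) $ (i, k)"
        using y(6)[of j k] by (simp add: tensor_vec_def vcnj_def X)
    qed
    moreover have "vcnj v' \<in> range ((*v) (ptranspose S))"
      using y(4) vcnj_mult[OF psd(2)] by auto
    ultimately have "X = 0 \<or> y = 0" using edge y(3) by metis
    with y(1,2) X show False by (metis zero_index)
  next
    assume c: "CARD('p) = 2 \<and> CARD('q) \<le> 3"
    obtain f :: "bool \<Rightarrow> 'p" where f: "bij f" using card_2_bij c by blast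
    have h: "bij (\<lambda>(i, k). (k :: 'q, f i))"
    proof -
      have "bij (\<lambda>(i, k). (f i, k :: 'q))"
        using bij_betw_map_prod[of f UNIV UNIV id UNIV UNIV] f by (simp add: map_prod_def)
      then have "bij (prod.swap \<circ> (\<lambda>(i, k). (f i, k :: 'q)))" by (rule bij_comp) simp
      then show ?thesis by (simp add: comp_def case_prod_beta')
    qed
    \<comment> \<open>With the two-dimensional factor second, the block transpose is
      \<open>ptranspose S\<close> itself.\<close>
    obtain x v v' and y :: "complex^'q" where y: "y \<noteq> 0" "x False \<noteq> 0 \<or> x True \<noteq> 0"
      "v \<in> range ((*v) S)" "v' \<in> range ((*v) (ptranspose S))"
      "\<And>i k. v $ (k, f i) = x i * y $ k" "\<And>i k. v' $ (k, f i) = cnj (x i) * y $ k"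
      by (rule wrapped_product_in_range[OF h conjunct2[OF c] psd \<open>S \<noteq> 0\<close>])
        (auto simp: ptranspose_def)
    define X where "X = (\<chi> i. x (inv f i))"
    have X: "X $ f i = x i" for i using f by (simp add: X_def bij_is_inj)
    have fs: "\<exists>j. i = f j" for i using f by (metis bij_pointE)
    have "v = tensor_vec y X"
    proof (unfold vec_eq_iff, clarify)
      fix k i
      obtain j where "i = f j" using fs by blast
      then show "v $ (k, i) = tensor_vec y X $ (k, i)" using y(5)[of k j] by (simp add: tensor_vec_def X)
    qed
    moreover have "v' = tensor_vec y (vcnj X)"
    proof (unfold vec_eq_iff, clarify)
      fix k i
      obtain j where "i = f j" using fs by blast
      then show "v' $ (k, i) = tensor_vec y (vcnj X) $ (k, i)"
        using y(6)[of k j] by (simp add: tensor_vec_def vcnj_def X)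
    qed
    ultimately have "X = 0 \<or> y = 0" using edge y(3,4) by metis
    with y(1,2) X show False by (metis zero_index)
  qed
qed

section \<open>The closed separable cone\<close>

lemma convex_cone_closure:
  fixes K :: "'a::real_normed_vector set"
  assumes "convex_cone K"
  shows "convex_cone (closure K)"
proof -
  have "0 \<in> closure K"
    using convex_cone_contains_0[OF assms] closure_subset by blast
  moreover have "x + y \<in> closure K" if xy: "x \<in> closure K" "y \<in> closure K" for x y
  proof -
    obtain a b where "\<And>n. a n \<in> K" "a \<longlonglongrightarrow> x" "\<And>n. b n \<in> K" "b \<longlonglongrightarrow> y"
      using xy unfolding closure_sequential by blast
    then have "\<forall>n. a n + b n \<in> K" "(\<lambda>n. a n + b n) \<longlonglongrightarrow> x + y"
      using convex_cone_add[OF assms] by (auto intro: tendsto_add)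
    then show ?thesis
      unfolding closure_sequential by (intro exI[of _ "\<lambda>n. a n + b n"] conjI)
  qed
  moreover have "c *\<^sub>R x \<in> closure K" if "0 \<le> c" "x \<in> closure K" for c x
  proof -
    have "c *\<^sub>R x \<in> closure ((*\<^sub>R) c ` K)"
      using that(2) closure_scaleR[of c K] by (metis imageI)
    also have "\<dots> \<subseteq> closure K"
      using convex_cone_scaleR[OF assms that(1)] by (intro closure_mono) auto
    finally show ?thesis .
  qed
  ultimately show ?thesis unfolding convex_cone_iff by blast
qed

lemma tensor_in_separable_cone:
  "psd s \<Longrightarrow> psd x \<Longrightarrow> s \<otimes>\<^sub>M x \<in> separable_cone"
  unfolding separable_cone_def by (intro hull_inc) blast

lemma psd_mat_1: "psd (mat 1)"
  by (simp add: psd_hip hip_self del: of_real_power)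

theorem corollary1p3:
  assumes "CARD('p::finite) * CARD('q::finite) \<le> 6"
  shows "(J :: (complex^('q \<times> 'p)^('q \<times> 'p)) set) \<subseteq> closure separable_cone"
proof
  fix S :: "complex^('q \<times> 'p)^('q \<times> 'p)"
  assume "S \<in> J"
  then have S: "psd S" "psd (ptranspose S)" by (rule J_imp_ppt)+
  let ?K = "separable_cone :: (complex^('q \<times> 'p)^('q \<times> 'p)) set"
  have pos: "CARD('p) > 0" "CARD('q) > 0" by simp_all
  \<comment> \<open>The other pairs of dimensions dominate (4, 2), (2, 4) or (3, 3), with product at
    least 8.\<close>
  consider "CARD('q) = 1" | "CARD('p) = 1"
    | "CARD('q) = 2 \<and> CARD('p) \<le> 3 \<or> CARD('p) = 2 \<and> CARD('q) \<le> 3"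
  proof -
    have "CARD('p) \<le> 3 \<or> CARD('q) \<le> 1"
    proof (rule ccontr)
      assume "\<not> ?thesis"
      then have "4 * 2 \<le> CARD('p) * CARD('q)" by (intro mult_le_mono) auto
      with assms show False by simp
    qed
    moreover have "CARD('q) \<le> 3 \<or> CARD('p) \<le> 1"
    proof (rule ccontr)
      assume "\<not> ?thesis"
      then have "2 * 4 \<le> CARD('p) * CARD('q)" by (intro mult_le_mono) auto
      with assms show False by simp
    qed
    moreover have "CARD('q) \<le> 2 \<or> CARD('p) \<le> 2"
    proof (rule ccontr)
      assume "\<not> ?thesis"
      then have "3 * 3 \<le> CARD('p) * CARD('q)" by (intro mult_le_mono) auto
      with assms show False by simp
    qed
    ultimately show thesis using that pos by linarith
  qed
  then show "S \<in> closure ?K"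
  proof cases
    case 1
    then obtain i :: 'q where i: "UNIV = {i}" by (metis card_1_singletonE)
    then have q: "(\<forall>a. P a) \<longleftrightarrow> P i" for P :: "'q \<Rightarrow> bool" by (metis UNIV_I singletonD)
    define X where "X = (\<chi> k l. S $ (i, k) $ (i, l))"
    \<comment> \<open>With a one-dimensional factor, \<open>S\<close> is itself an elementary
      tensor.\<close>
    have "S = mat 1 \<otimes>\<^sub>M X"
      by (simp add: tensor_mat_def X_def mat_def vec_eq_iff q)
    moreover have "psd X"
      unfolding psd_hip
    proof
      fix v
      have sumq: "(\<Sum>a\<in>UNIV. f a) = (\<Sum>k\<in>UNIV. f (i, k))" for f :: "'q \<times> 'p \<Rightarrow> complex"
        by (simp add: i sum.cartesian_product' flip: UNIV_Times_UNIV)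
      have "hip v (X *v v) = hip (\<chi> a. v $ snd a) (S *v (\<chi> a. v $ snd a))"
        by (simp add: hip_def matrix_vector_mult_def sumq X_def)
      then show "hip v (X *v v) \<in> \<real>\<^sub>\<ge>\<^sub>0" using S(1) by (simp add: psd_hip)
    qed
    ultimately show ?thesis
      using tensor_in_separable_cone[OF psd_mat_1] closure_subset by blast
  next
    case 2
    then obtain i :: 'p where i: "UNIV = {i}" by (metis card_1_singletonE)
    then have q: "(\<forall>a. P a) \<longleftrightarrow> P i" for P :: "'p \<Rightarrow> bool" by (metis UNIV_I singletonD)
    define X where "X = (\<chi> k l. S $ (k, i) $ (l, i))"
    have "S = X \<otimes>\<^sub>M mat 1"
      by (simp add: tensor_mat_def X_def mat_def vec_eq_iff q)
    moreover have "psd X"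
      unfolding psd_hip
    proof
      fix v
      have sumq: "(\<Sum>a\<in>UNIV. f a) = (\<Sum>k\<in>UNIV. f (k, i))" for f :: "'q \<times> 'p \<Rightarrow> complex"
        by (simp add: i sum.cartesian_product' flip: UNIV_Times_UNIV)
      have "hip v (X *v v) = hip (\<chi> a. v $ fst a) (S *v (\<chi> a. v $ fst a))"
        by (simp add: hip_def matrix_vector_mult_def sumq X_def)
      then show "hip v (X *v v) \<in> \<real>\<^sub>\<ge>\<^sub>0" using S(1) by (simp add: psd_hip)
    qed
    ultimately show ?thesis
      using tensor_in_separable_cone[OF _ psd_mat_1] closure_subset by blast
  next
    case 3
    have "convex_cone (closure ?K)"
      unfolding separable_cone_def by (intro convex_cone_closure convex_cone_convex_cone_hull)
    moreover have "outer (tensor_vec x y) \<in> closure ?K" for x :: "complex^'q" and y :: "complex^'p"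
      unfolding outer_tensor_vec using tensor_in_separable_cone[OF psd_outer psd_outer] closure_subset by blast
    ultimately obtain T where "T \<in> closure ?K" "edge (S - T)"
      using exists_edge_remainder[OF closed_closure _ _ S] by blast
    moreover then have "S - T = 0" using 3 by (intro edge_eq_0)
    ultimately show ?thesis by simp
  qed
qed

end
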